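(* Let $m\in\mathbb{N}$. For any centered Gaussian random vector $(X_1,X_2,X_3)$ (each $X_i$ real-valued with positive variance), $$E[X_1^{2m}X_2^{6}X_3^{4}]\ge E[X_1^{2m}]\,E[X_2^{6}]\,E[X_3^{4}],$$ and equality holds if and only if $X_1,X_2,X_3$ are independent.
   Context: All Gaussian random variables are assumed real-valued and non-degenerate (positive variance). $\mathbb{N}=\{1,2,3,\dots\}$. *)

theory Defs
  imports "HOL-Probability.Probability"
begin

definition (in prob_space) centered_gaussian_rv :: "('a \<Rightarrow> real) \<Rightarrow> bool" where
  "centered_gaussian_rv Y \<longleftrightarrow> random_variable borel Y \<and>
     ((AE x in M. Y x = 0) \<or> (\<exists>\<sigma>>0. distributed M lborel Y (normal_density 0 \<sigma>)))"

definition (in prob_space) centered_gaussian_vector :: "(nat \<Rightarrow> 'a \<Rightarrow> real) \<Rightarrow> nat set \<Rightarrow> bool" where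
  "centered_gaussian_vector X I \<longleftrightarrow>
     (\<forall>c :: nat \<Rightarrow> real. centered_gaussian_rv (\<lambda>\<omega>. \<Sum>i\<in>I. c i * X i \<omega>))"

end

theory Submission
  imports Defs
begin

text \<open>
  Normalise the variances to one and write \<open>a\<close>, \<open>b\<close>, \<open>c\<close> for the correlations of \<open>(X\<^sub>1,X\<^sub>2)\<close>,
  \<open>(X\<^sub>1,X\<^sub>3)\<close>, \<open>(X\<^sub>2,X\<^sub>3)\<close>. Expanding \<open>X\<^sub>1\<^sup>2\<^sup>m\<close> in Hermite polynomials shows that the quotient of
  \<open>E[X\<^sub>1\<^sup>2\<^sup>m X\<^sub>2\<^sup>6 X\<^sub>3\<^sup>4]\<close> by \<open>E[X\<^sub>1\<^sup>2\<^sup>m]\<close> is a combination of the homogeneous parts in \<open>(A, B)\<close> of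
  the polynomial \<open>E[(X\<^sub>2 + A)\<^sup>6 (X\<^sub>3 + B)\<^sup>4]\<close> at \<open>A = a \<surd>(2m)\<close>, \<open>B = b \<surd>(2m)\<close>: the part of degree
  \<open>2j\<close> has weight \<open>\<Prod>\<^sub>i\<^sub><\<^sub>j (1 - i/m)\<close> (this identity is verified by Gram--Schmidt
  orthogonalisation rather than through Hermite polynomials). In these coordinates the inequality survives the limit
  \<open>m \<rightarrow> \<infinity>\<close>, and sum-of-squares certificates, which use only the nonnegativity of the Gram
  determinant of the correlations, bound the combination from below by \<open>45 + A\<^sup>2 + B\<^sup>2 + c\<^sup>2\<close>, where
  \<open>45 = E[X\<^sub>2\<^sup>6] E[X\<^sub>3\<^sup>4]\<close>. Equality therefore forces all correlations to vanish, and uncorrelated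
  jointly Gaussian variables are independent.
\<close>

section \<open>Independence of uncorrelated Gaussian variables\<close>

text \<open>The function \<open>W / E[W]\<close> is a probability density. Under the reweighted
  measure \<open>N\<close> the variable \<open>Y\<close> has the same characteristic function as
  under \<open>M\<close>, hence by Levy's uniqueness theorem the same law. If
  \<open>E[W] = 0\<close>, then \<open>W\<close> vanishes almost everywhere and both sides are
  zero.\<close>

lemma (in prob_space) expectation_weight_indicator:
  fixes W Y :: "'a \<Rightarrow> real"
  assumes [measurable]: "random_variable borel W" "random_variable borel Y" "B \<in> sets borel"
    and W: "\<And>x. 0 \<le> W x" "\<And>x. W x \<le> C"
    and char: "\<And>s. (CLINT x|M. complex_of_real (W x) * iexp (s * Y x))
                 = char (distr M borel Y) s * expectation W"
  shows "expectation (\<lambda>x. W x * indicator B (Y x)) = expectation W * prob (Y -` B \<inter> space M)"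
proof -
  have int: "integrable M W"
    by (rule integrable_const_bound[where B = C]) (use W in auto)
  have nn: "0 \<le> expectation W" using W by simp
  have C: "0 \<le> C" using W by (rule order_trans)
  show ?thesis
  proof (cases "expectation W = 0")
    case True
    then have "AE x in M. W x = 0"
      using int W by (subst (asm) integral_nonneg_eq_0_iff_AE) auto
    then have "expectation (\<lambda>x. W x * indicator B (Y x)) = expectation (\<lambda>x. 0)"
      by (intro integral_cong_AE) auto
    then show ?thesis using True by simp
  next
    case False
    define e where "e = expectation W"
    have e: "e > 0" using False nn unfolding e_def by simp
    define N where "N = density M (\<lambda>x. W x / e)"
    have emb: "emeasure N A = ennreal (expectation (\<lambda>x. W x / e * indicator A x))" if "A \<in> sets M" for A
    proof -
      have "emeasure N A = (\<integral>\<^sup>+x. ennreal (W x / e * indicator A x) \<partial>M)"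
        using that unfolding N_def
        by (subst emeasure_density) (auto intro!: nn_integral_cong split: split_indicator)
      also have "\<dots> = ennreal (expectation (\<lambda>x. W x / e * indicator A x))"
        using that W e C
        by (intro nn_integral_eq_integral integrable_const_bound[where B = "C / e"])
           (auto simp: divide_right_mono split: split_indicator intro: order_trans[OF W(1) W(2)])
      finally show ?thesis .
    qed
    have "emeasure N (space N) = 1"
      using emb[of "space M"] e False
      by (simp add: N_def e_def cong: Bochner_Integration.integral_cong)
    then interpret N: prob_space N by (rule prob_spaceI)
    have mN[measurable]: "Y \<in> borel_measurable N" by (simp add: N_def)
    have "distr N borel Y = distr M borel Y"
    proof (rule Levy_uniqueness)
      show "real_distribution (distr N borel Y)" by (rule N.real_distribution_distr) simp
      show "real_distribution (distr M borel Y)" by (rule real_distribution_distr) simp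
      show "char (distr N borel Y) = char (distr M borel Y)"
      proof
        fix s
        have "char (distr N borel Y) s = (CLINT x|N. iexp (s * Y x))"
          by (simp add: char_def integral_distr)
        also have "\<dots> = (CLINT x|M. (W x / e) *\<^sub>R iexp (s * Y x))"
          unfolding N_def by (rule integral_density) (use W e in auto)
        also have "\<dots> = (CLINT x|M. complex_of_real (W x) * iexp (s * Y x)) / e"
          by (simp add: scaleR_conv_of_real)
        also have "\<dots> = char (distr M borel Y) s"
          unfolding char e_def[symmetric] using e by simp
        finally show "char (distr N borel Y) s = char (distr M borel Y) s" .
      qed
    qed
    then have "emeasure N (Y -` B \<inter> space M) = emeasure M (Y -` B \<inter> space M)"
      using emeasure_distr[of Y N borel B] emeasure_distr[of Y M borel B] by (simp add: N_def)
    moreover have "indicator (Y -` B \<inter> space M) x = (indicator B (Y x) :: real)" if "x \<in> space M" for x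
      using that by (auto simp: indicator_def)
    ultimately have "ennreal (expectation (\<lambda>x. W x / e * indicator B (Y x))) = ennreal (prob (Y -` B \<inter> space M))"
      by (subst (asm) emb) (simp_all add: emeasure_eq_measure cong: Bochner_Integration.integral_cong)
    then have "expectation (\<lambda>x. W x / e * indicator B (Y x)) = prob (Y -` B \<inter> space M)"
      using W e by (subst (asm) ennreal_inj) (auto intro!: integral_nonneg_AE)
    then show ?thesis using e by (simp add: e_def field_simps)
  qed
qed

text \<open>A complex exponential is not a nonnegative weight, so the real and imaginary parts are
  treated separately: the preceding lemma is applied to the weights \<open>V\<close>,
  \<open>V * (1 + cos Z)\<close> and \<open>V * (1 + sin Z)\<close>, and the first is subtracted
  from the other two.\<close>

lemma (in prob_space) expectation_weight_indicator_iexp: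
  fixes V Y Z :: "'a \<Rightarrow> real"
  assumes [measurable]: "random_variable borel V" "random_variable borel Y"
      "random_variable borel Z" "B \<in> sets borel"
    and V: "\<And>x. 0 \<le> V x" "\<And>x. V x \<le> 1"
    and char0: "\<And>s. (CLINT x|M. complex_of_real (V x) * iexp (s * Y x))
                 = char (distr M borel Y) s * expectation V"
    and charZ: "\<And>s. (CLINT x|M. complex_of_real (V x) * iexp (s * Y x + Z x))
                 = char (distr M borel Y) s * (CLINT x|M. complex_of_real (V x) * iexp (Z x))"
  shows "(CLINT x|M. complex_of_real (V x * indicator B (Y x)) * iexp (Z x))
       = prob (Y -` B \<inter> space M) * (CLINT x|M. complex_of_real (V x) * iexp (Z x))"
proof -
  have int: "integrable M (\<lambda>x. complex_of_real (V x) * iexp (f x))"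
    if [measurable]: "f \<in> borel_measurable M" for f
    by (rule integrable_const_bound[where B = 1]) (use V in \<open>auto simp: norm_mult\<close>)
  have intV: "integrable M V"
    by (rule integrable_const_bound[where B = 1]) (use V in auto)
  have int2: "integrable M (\<lambda>x. V x * f x)" if [measurable]: "f \<in> borel_measurable M" 
    and "\<And>x. \<bar>f x\<bar> \<le> 1" for f :: "'a \<Rightarrow> real"
    by (rule integrable_const_bound[where B = 1])
       (use V that in \<open>auto simp: abs_mult intro!: mult_le_one\<close>)
  have int3: "integrable M (\<lambda>x. V x * f x * indicator B (Y x))" if [measurable]: "f \<in> borel_measurable M" 
    and "\<And>x. \<bar>f x\<bar> \<le> 1" for f :: "'a \<Rightarrow> real"
    using that by (intro integrable_const_bound[where B = 1])
       (use V that in \<open>auto simp: abs_mult split: split_indicator intro!: mult_le_one\<close>)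
  define z where "z = (CLINT x|M. complex_of_real (V x) * iexp (Z x))"
  \<comment> \<open>Complex conjugation of \<open>charZ\<close> at frequency \<open>-s\<close> gives
    the factorisation with \<open>Z\<close> replaced by \<open>-Z\<close>; Euler's formulas then
    yield it for \<open>V * cos Z\<close> and \<open>V * sin Z\<close>.\<close>
  have neg: "(CLINT x|M. complex_of_real (V x) * iexp (s * Y x - Z x))
                 = char (distr M borel Y) s * cnj z" for s
  proof -
    have "(CLINT x|M. complex_of_real (V x) * iexp (s * Y x - Z x))
        = (CLINT x|M. cnj (complex_of_real (V x) * iexp ((-s) * Y x + Z x)))"
      by (intro Bochner_Integration.integral_cong refl) (simp add: exp_cnj algebra_simps)
    also have "\<dots> = cnj (CLINT x|M. complex_of_real (V x) * iexp ((-s) * Y x + Z x))"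
      by (rule Bochner_Integration.integral_cnj)
    also have "\<dots> = cnj (char (distr M borel Y) (-s)) * cnj z"
      unfolding charZ by (simp add: z_def)
    also have "cnj (char (distr M borel Y) (-s)) = char (distr M borel Y) s"
      unfolding char_def Bochner_Integration.integral_cnj[symmetric] by (simp add: exp_cnj)
    finally show ?thesis .
  qed
  have cosZ: "expectation (\<lambda>x. V x * cos (Z x)) = Re z" and sinZ: "expectation (\<lambda>x. V x * sin (Z x)) = Im z"
    unfolding z_def using integral_Re[OF int[of Z]] integral_Im[OF int[of Z]]
    by (simp_all add: Re_exp Im_exp)
  \<comment> \<open>Since \<open>f\<close> takes values in [-1, 1], the weight
    \<open>V * (1 + f)\<close> is nonnegative and bounded by 2.\<close>
  have key: "expectation (\<lambda>x. V x * (1 + f x) * indicator B (Y x))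
      = expectation (\<lambda>x. V x * (1 + f x)) * prob (Y -` B \<inter> space M)"
    if [measurable]: "f \<in> borel_measurable M" and f: "\<And>x. \<bar>f x\<bar> \<le> 1"
      and feq: "\<And>s. (CLINT x|M. complex_of_real (V x * f x) * iexp (s * Y x))
        = char (distr M borel Y) s * expectation (\<lambda>x. V x * f x)" for f
  proof (rule expectation_weight_indicator[where C = 2])
    fix s
    have i1: "integrable M (\<lambda>x. complex_of_real (V x * f x) * iexp (s * Y x))"
      by (rule integrable_const_bound[where B = 1])
         (use V f in \<open>auto simp: norm_mult abs_mult intro!: mult_le_one\<close>)
    have "(CLINT x|M. complex_of_real (V x * (1 + f x)) * iexp (s * Y x))
       = (CLINT x|M. complex_of_real (V x) * iexp (s * Y x) + complex_of_real (V x * f x) * iexp (s * Y x))"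
      by (intro Bochner_Integration.integral_cong refl) (simp add: algebra_simps)
    also have "\<dots> = char (distr M borel Y) s * (expectation V + expectation (\<lambda>x. V x * f x))"
      unfolding distrib_left of_real_add char0[symmetric] feq[symmetric]
      by (rule Bochner_Integration.integral_add[OF int i1]) simp
    also have "expectation V + expectation (\<lambda>x. V x * f x) = expectation (\<lambda>x. V x * (1 + f x))"
      using intV int2[OF _ f] by (simp add: algebra_simps)
    finally show "(CLINT x|M. complex_of_real (V x * (1 + f x)) * iexp (s * Y x))
      = char (distr M borel Y) s * expectation (\<lambda>x. V x * (1 + f x))"
      by simp
    fix x
    have "-1 \<le> f x" "f x \<le> 1" using f[of x] by auto
    then show "0 \<le> V x * (1 + f x)" "V x * (1 + f x) \<le> 2"
      using V[of x] mult_mono[of "V x" 1 "1 + f x" 2] by auto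
  qed auto
  have split: "expectation (\<lambda>x. V x * (1 + f x) * indicator B (Y x))
      = expectation (\<lambda>x. V x * indicator B (Y x)) + expectation (\<lambda>x. V x * f x * indicator B (Y x))"
      "expectation (\<lambda>x. V x * (1 + f x)) = expectation V + expectation (\<lambda>x. V x * f x)"
    if [measurable]: "f \<in> borel_measurable M" and f: "\<And>x. \<bar>f x\<bar> \<le> 1" for f
    using int3[of "\<lambda>_. 1"] int3[OF _ f] intV int2[OF _ f] by (simp_all add: algebra_simps)
  have zero: "expectation (\<lambda>x. V x * indicator B (Y x)) = expectation V * prob (Y -` B \<inter> space M)"
    by (rule expectation_weight_indicator[where C = 1]) (use V char0 in auto)
  have key': "expectation (\<lambda>x. V x * f x * indicator B (Y x))
      = expectation (\<lambda>x. V x * f x) * prob (Y -` B \<inter> space M)"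
    if "f \<in> borel_measurable M" "\<And>x. \<bar>f x\<bar> \<le> 1"
      "\<And>s. (CLINT x|M. complex_of_real (V x * f x) * iexp (s * Y x))
        = char (distr M borel Y) s * expectation (\<lambda>x. V x * f x)" for f
    using key[OF that] zero unfolding split[OF that(1,2)] by (simp add: algebra_simps)
  have c: "expectation (\<lambda>x. V x * cos (Z x) * indicator B (Y x)) = Re z * prob (Y -` B \<inter> space M)"
    unfolding cosZ[symmetric]
  proof (rule key')
    fix s
    have "(CLINT x|M. complex_of_real (V x * cos (Z x)) * iexp (s * Y x))
      = (CLINT x|M. (complex_of_real (V x) * iexp (s * Y x + Z x) + complex_of_real (V x) * iexp (s * Y x - Z x)) / 2)"
      by (intro Bochner_Integration.integral_cong refl)
         (simp add: cos_of_real[symmetric] cos_exp_eq exp_add exp_diff exp_minus field_simps)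
    also have "\<dots> = (char (distr M borel Y) s * z + char (distr M borel Y) s * cnj z) / 2"
      unfolding z_def[symmetric] charZ[folded z_def, symmetric] neg[symmetric]
      by (subst integral_divide_zero, subst Bochner_Integration.integral_add[OF int int]) simp_all
    also have "\<dots> = char (distr M borel Y) s * Re z"
      by (simp add: complex_add_cnj flip: distrib_left)
    finally show "(CLINT x|M. complex_of_real (V x * cos (Z x)) * iexp (s * Y x))
      = char (distr M borel Y) s * expectation (\<lambda>x. V x * cos (Z x))" unfolding cosZ .
  qed auto
  have s: "expectation (\<lambda>x. V x * sin (Z x) * indicator B (Y x)) = Im z * prob (Y -` B \<inter> space M)"
    unfolding sinZ[symmetric]
  proof (rule key')
    fix s
    have "(CLINT x|M. complex_of_real (V x * sin (Z x)) * iexp (s * Y x))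
      = (CLINT x|M. (complex_of_real (V x) * iexp (s * Y x + Z x) - complex_of_real (V x) * iexp (s * Y x - Z x)) / (2 * \<i>))"
      by (intro Bochner_Integration.integral_cong refl)
         (simp add: sin_of_real[symmetric] sin_exp_eq exp_add exp_diff exp_minus field_simps)
    also have "\<dots> = (char (distr M borel Y) s * z - char (distr M borel Y) s * cnj z) / (2 * \<i>)"
      unfolding z_def[symmetric] charZ[folded z_def, symmetric] neg[symmetric]
      by (subst integral_divide_zero, subst Bochner_Integration.integral_diff[OF int int]) simp_all
    also have "\<dots> = char (distr M borel Y) s * Im z"
    proof -
      have "z - cnj z = (2 * \<i>) * Im z" by (simp add: complex_diff_cnj)
      then have "c * z - c * cnj z = (2 * \<i>) * (c * Im z)" for c :: complex
        by (simp flip: right_diff_distrib)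
      then show ?thesis by simp
    qed
    finally show "(CLINT x|M. complex_of_real (V x * sin (Z x)) * iexp (s * Y x))
      = char (distr M borel Y) s * expectation (\<lambda>x. V x * sin (Z x))" unfolding sinZ .
  qed auto
  have i: "integrable M (\<lambda>x. complex_of_real (V x * indicator B (Y x)) * iexp (Z x))"
    by (rule integrable_const_bound[where B = 1])
       (use V in \<open>auto simp: norm_mult abs_mult split: split_indicator\<close>)
  show ?thesis
    unfolding z_def[symmetric]
  proof (rule complex_eqI)
    show "Re (CLINT x|M. complex_of_real (V x * indicator B (Y x)) * iexp (Z x)) = Re (prob (Y -` B \<inter> space M) * z)"
      unfolding integral_Re[OF i, symmetric] using c by (simp add: Re_exp mult_ac)
    show "Im (CLINT x|M. complex_of_real (V x * indicator B (Y x)) * iexp (Z x)) = Im (prob (Y -` B \<inter> space M) * z)"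
      unfolding integral_Im[OF i, symmetric] using s by (simp add: Im_exp mult_ac)
  qed
qed

text \<open>Kac's criterion: conditioning on the events one variable at a time turns the exponential factors
  into indicators.\<close>

lemma (in prob_space) indep_vars_if_char_sum:
  fixes Y :: "'i \<Rightarrow> 'a \<Rightarrow> real"
  assumes I: "finite I" "I \<noteq> {}"
    and rv: "\<And>i. i \<in> I \<Longrightarrow> random_variable borel (Y i)"
    and char: "\<And>c. (CLINT x|M. iexp (\<Sum>i\<in>I. c i * Y i x)) = (\<Prod>i\<in>I. char (distr M borel (Y i)) (c i))"
  shows "indep_vars (\<lambda>_. borel) Y I"
proof -
  have [measurable]: "(\<lambda>x. \<Sum>i\<in>J. c i * Y i x) \<in> borel_measurable M" if "J \<subseteq> I" for c J
    using that rv by (intro borel_measurable_sum) auto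
  \<comment> \<open>Induction on the set \<open>J\<close> of variables whose exponential factor is
    already an indicator: the empty set is the hypothesis \<open>char\<close>, and
    \<open>J = I\<close> gives the probability of a product event.\<close>
  have main: "(CLINT x|M. complex_of_real (\<Prod>j\<in>J. indicator (B j) (Y j x)) * iexp (\<Sum>i\<in>I - J. c i * Y i x))
      = of_real (\<Prod>j\<in>J. prob (Y j -` B j \<inter> space M)) * (\<Prod>i\<in>I - J. char (distr M borel (Y i)) (c i))"
    if B: "\<And>i. i \<in> I \<Longrightarrow> B i \<in> sets borel" and J: "J \<subseteq> I" for B c J
    using finite_subset[OF J I(1)] J
  proof (induction J arbitrary: c rule: finite_induct)
    case empty
    then show ?case using char[of c] by simp
  next
    case (insert k J)
    define V where "V x = (\<Prod>j\<in>J. indicator (B j) (Y j x) :: real)" for x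
    define p where "p = (\<Prod>j\<in>J. prob (Y j -` B j \<inter> space M))"
    define K where "K = I - insert k J"
    have K: "I - J = insert k K" "k \<notin> K" "finite K" "k \<in> I" "K \<subseteq> I"
      using insert.hyps insert.prems I unfolding K_def by auto
    have IH: "(CLINT x|M. complex_of_real (V x) * iexp (c k * Y k x + (\<Sum>i\<in>K. c i * Y i x)))
      = p * (char (distr M borel (Y k)) (c k) * (\<Prod>i\<in>K. char (distr M borel (Y i)) (c i)))" for c
      using insert.IH[of c] insert.prems K unfolding V_def p_def by simp
    have sumeq: "(\<Sum>i\<in>K. (c(k := s)) i * Y i x) = (\<Sum>i\<in>K. c i * Y i x)" for c s x
      using K by (intro sum.cong) auto
    have prodeq: "(\<Prod>i\<in>K. char (distr M borel (Y i)) ((c(k := s)) i)) = (\<Prod>i\<in>K. char (distr M borel (Y i)) (c i))" for c s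
      using K by (intro prod.cong) auto
    have char0: "char (distr M borel (Y i)) 0 = 1" if "i \<in> I" for i
      using rv[OF that] by (intro real_distribution.char_zero real_distribution_distr)
    \<comment> \<open>Changing \<open>c\<close> only at \<open>k\<close> makes the frequency
      \<open>s\<close> of \<open>Y k\<close> a free variable. The choices \<open>c = 0\<close> and
      \<open>s = 0\<close> then give \<open>IH0\<close> and \<open>IHZ\<close>, from which the value
      of each weighted integral is read off.\<close>
    have IH': "(CLINT x|M. complex_of_real (V x) * iexp (s * Y k x + (\<Sum>i\<in>K. c i * Y i x)))
      = p * (char (distr M borel (Y k)) s * (\<Prod>i\<in>K. char (distr M borel (Y i)) (c i)))" for c s
      using IH[of "c(k := s)"] unfolding sumeq prodeq by simp
    have IH0: "(CLINT x|M. complex_of_real (V x) * iexp (s * Y k x)) = p * char (distr M borel (Y k)) s" for s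
    proof -
      have "(\<Prod>i\<in>K. char (distr M borel (Y i)) 0) = 1" using K char0 by (intro prod.neutral) auto
      then show ?thesis using IH'[of s "\<lambda>_. 0"] by simp
    qed
    have IHZ: "(CLINT x|M. complex_of_real (V x) * iexp (\<Sum>i\<in>K. c i * Y i x))
      = p * (\<Prod>i\<in>K. char (distr M borel (Y i)) (c i))"
      using IH'[of 0 c] char0[of k] K by simp
    have "complex_of_real (expectation V) = complex_of_real p"
      using IH0[of 0] char0[of k] K by simp
    then have Vp: "expectation V = p" by (simp only: of_real_eq_iff)
    have [measurable]: "V \<in> borel_measurable M"
      unfolding V_def using insert.prems rv B
      by (intro borel_measurable_prod measurable_compose[OF rv]) auto
    have step: "(CLINT x|M. complex_of_real (V x * indicator (B k) (Y k x)) * iexp (\<Sum>i\<in>K. c i * Y i x))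
       = prob (Y k -` B k \<inter> space M) * (CLINT x|M. complex_of_real (V x) * iexp (\<Sum>i\<in>K. c i * Y i x))"
    proof (rule expectation_weight_indicator_iexp)
      show "random_variable borel V" by simp
      show "random_variable borel (Y k)" using rv K by simp
      show "random_variable borel (\<lambda>x. \<Sum>i\<in>K. c i * Y i x)" using K by simp
      show "B k \<in> sets borel" using B K by simp
      show "0 \<le> V x" "V x \<le> 1" for x
        unfolding V_def by (auto intro!: prod_nonneg prod_le_1)
      show "(CLINT x|M. complex_of_real (V x) * iexp (s * Y k x))
          = char (distr M borel (Y k)) s * expectation V" for s
        unfolding IH0 Vp by (rule mult.commute)
      show "(CLINT x|M. complex_of_real (V x) * iexp (s * Y k x + (\<Sum>i\<in>K. c i * Y i x)))
          = char (distr M borel (Y k)) s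
            * (CLINT x|M. complex_of_real (V x) * iexp (\<Sum>i\<in>K. c i * Y i x))" for s
        unfolding IH' IHZ by (rule mult.left_commute)
    qed
    have prodV: "(\<Prod>j\<in>insert k J. indicator (B j) (Y j x)) = V x * indicator (B k) (Y k x)" for x
      using insert.hyps by (simp add: V_def)
    show ?case
      unfolding K_def[symmetric] prodV step IHZ using insert.hyps by (simp add: p_def)
  qed
  show ?thesis
  proof (subst indep_vars_finite[where E = "\<lambda>_. sets borel"])
    show "\<forall>A\<in>I \<rightarrow> sets borel. prob (\<Inter>j\<in>I. Y j -` A j \<inter> space M) = (\<Prod>j\<in>I. prob (Y j -` A j \<inter> space M))"
    proof
      fix A :: "'i \<Rightarrow> real set" assume A: "A \<in> I \<rightarrow> sets borel"
      have meas: "(\<Inter>j\<in>I. Y j -` A j \<inter> space M) \<in> events"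
        using I A rv by (intro sets.finite_INT) (auto intro!: measurable_sets)
      have "complex_of_real (\<Prod>j\<in>I. prob (Y j -` A j \<inter> space M))
          = complex_of_real (expectation (\<lambda>x. \<Prod>j\<in>I. indicator (A j) (Y j x)))"
        using main[of A I "\<lambda>_. 0"] A by (simp add: Pi_iff del: of_real_prod)
      then have "(\<Prod>j\<in>I. prob (Y j -` A j \<inter> space M)) = expectation (\<lambda>x. \<Prod>j\<in>I. indicator (A j) (Y j x))"
        by (simp only: of_real_eq_iff)
      also have "\<dots> = expectation (indicator (\<Inter>j\<in>I. Y j -` A j \<inter> space M))"
        using I by (intro Bochner_Integration.integral_cong refl) (auto simp: indicator_def prod_zero_iff)
      also have "\<dots> = prob (\<Inter>j\<in>I. Y j -` A j \<inter> space M)" using meas by simp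
      finally show "prob (\<Inter>j\<in>I. Y j -` A j \<inter> space M) = (\<Prod>j\<in>I. prob (Y j -` A j \<inter> space M))" ..
    qed
  qed (use I rv sets.sigma_sets_eq[of "borel :: real measure"] in \<open>auto simp: Int_stable_def\<close>)
qed

section \<open>Moments and characteristic functions of centered Gaussian variables\<close>

context prob_space
begin

text \<open>The degenerate variable is the case \<sigma> = 0, so that the same formulas cover both
  alternatives of the definition; at \<open>k = 0\<close> this relies on 0^0 = 1. The degenerate
  case does occur, since the residuals of the orthogonalisation below may vanish.\<close>

lemma centered_gaussian_rvE:
  assumes "centered_gaussian_rv Y"
  obtains \<sigma> where "random_variable borel Y"
    and "\<And>k. integrable M (\<lambda>x. Y x ^ k)"
    and "\<And>k. odd k \<Longrightarrow> expectation (\<lambda>x. Y x ^ k) = 0"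
    and "\<And>k. expectation (\<lambda>x. Y x ^ (2 * k)) = fact (2 * k) / (2 ^ k * fact k) * \<sigma> ^ (2 * k)"
    and "\<And>t. char (distr M borel Y) t = exp (- (\<sigma> * t)\<^sup>2 / 2)"
proof -
  have rv[measurable]: "random_variable borel Y"
    using assms unfolding centered_gaussian_rv_def by auto
  consider (zero) "AE x in M. Y x = 0"
    | (normal) \<sigma> where "\<sigma> > 0" "distributed M lborel Y (normal_density 0 \<sigma>)"
    using assms unfolding centered_gaussian_rv_def by auto
  then show thesis
  proof cases
    case zero
    have eq: "expectation (\<lambda>x. Y x ^ k) = 0 ^ k" for k
    proof -
      have "expectation (\<lambda>x. Y x ^ k) = expectation (\<lambda>x. 0 ^ k)"
        using zero by (intro integral_cong_AE) auto
      then show ?thesis by (simp add: prob_space)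
    qed
    show thesis
    proof (rule that[of 0])
      show "integrable M (\<lambda>x. Y x ^ k)" for k
        by (subst integrable_cong_AE[of _ M "\<lambda>x. 0 ^ k"]) (use zero in auto)
      show "char (distr M borel Y) t = exp (- (0 * t)\<^sup>2 / 2)" for t
      proof -
        have "char (distr M borel Y) t = (CLINT x|M. iexp (t * Y x))"
          by (simp add: char_def integral_distr)
        also have "\<dots> = (CLINT x|M. 1)"
          using zero by (intro integral_cong_AE) auto
        finally show ?thesis by (simp add: prob_space)
      qed
    qed (auto simp: eq rv power_0_left odd_pos)
  next
    case normal
    note D = normal(2)
    have int: "integrable M (\<lambda>x. Y x ^ k)" for k
      using distributed_integrable[OF D, of "\<lambda>x. x ^ k"] integrable_normal_moment[OF normal(1), of 0 k]
      by simp
    have moment: "expectation (\<lambda>x. Y x ^ k) = (LBINT x. normal_density 0 \<sigma> x * x ^ k)" for k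
      using distributed_integral[OF D, of "\<lambda>x. x ^ k"] by simp
    show thesis
    proof (rule that[of \<sigma>])
      show "expectation (\<lambda>x. Y x ^ k) = 0" if "odd k" for k
        using that has_bochner_integral_integral_eq[OF normal_moment_odd[OF normal(1), of 0 "(k - 1) div 2"]]
        unfolding moment by (auto elim!: oddE)
      show "expectation (\<lambda>x. Y x ^ (2 * k)) = fact (2 * k) / (2 ^ k * fact k) * \<sigma> ^ (2 * k)" for k
        using has_bochner_integral_integral_eq[OF normal_moment_even[OF normal(1), of 0 k]] normal(1)
        unfolding moment by (simp add: power_divide power_mult)
      show "char (distr M borel Y) t = exp (- (\<sigma> * t)\<^sup>2 / 2)" for t
      proof -
        have S: "distributed M lborel (\<lambda>x. Y x / \<sigma>) std_normal_density"
          using normal_standard_normal_convert[OF normal(1), of Y 0] D by simp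
        have "(\<sigma> * t) * (y / \<sigma>) = t * y" for y using normal(1) by simp
        then have "char (distr M borel Y) t = (CLINT x|M. iexp ((\<sigma> * t) * (Y x / \<sigma>)))"
          by (subst char_def, subst integral_distr) (simp_all only: rv, measurable)
        also have "\<dots> = char (distr M lborel (\<lambda>x. Y x / \<sigma>)) (\<sigma> * t)"
          by (subst char_def, subst integral_distr) auto
        also have "\<dots> = exp (- (\<sigma> * t)\<^sup>2 / 2)"
          unfolding distributed_distr_eq_density[OF S] char_std_normal_distribution ..
        finally show ?thesis .
      qed
    qed (use int rv in auto)
  qed
qed

lemma centered_gaussian_rv_measurable: "centered_gaussian_rv Y \<Longrightarrow> random_variable borel Y"
  by (rule centered_gaussian_rvE)

lemma centered_gaussian_integrable_power: "centered_gaussian_rv Y \<Longrightarrow> integrable M (\<lambda>x. Y x ^ k)"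
  by (rule centered_gaussian_rvE)

lemma centered_gaussian_odd_moment:
  "centered_gaussian_rv Y \<Longrightarrow> odd k \<Longrightarrow> expectation (\<lambda>x. Y x ^ k) = 0"
  by (erule centered_gaussian_rvE) simp

text \<open>The case \<open>k = 1\<close> identifies \<sigma>^2 with the second moment, which
  removes the auxiliary parameter.\<close>

lemma centered_gaussian_even_moment:
  assumes "centered_gaussian_rv Y"
  shows "expectation (\<lambda>x. Y x ^ (2 * k)) = fact (2 * k) / (2 ^ k * fact k) * expectation (\<lambda>x. Y x ^ 2) ^ k"
proof -
  obtain \<sigma> where "\<And>k. expectation (\<lambda>x. Y x ^ (2 * k)) = fact (2 * k) / (2 ^ k * fact k) * \<sigma> ^ (2 * k)"
    by (rule centered_gaussian_rvE[OF assms]) blast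
  from this[of k] this[of 1] show ?thesis by (simp add: power_mult)
qed

lemma centered_gaussian_char:
  assumes "centered_gaussian_rv Y"
  shows "char (distr M borel Y) t = exp (- expectation (\<lambda>x. Y x ^ 2) * t\<^sup>2 / 2)"
proof -
  obtain \<sigma> where *: "\<And>k. expectation (\<lambda>x. Y x ^ (2 * k)) = fact (2 * k) / (2 ^ k * fact k) * \<sigma> ^ (2 * k)"
      "\<And>t. char (distr M borel Y) t = exp (- (\<sigma> * t)\<^sup>2 / 2)"
    by (rule centered_gaussian_rvE[OF assms]) blast
  from *(1)[of 1] show ?thesis unfolding *(2) by (simp add: power_mult_distrib)
qed

lemma integrable_mult_square:
  fixes f g :: "'a \<Rightarrow> real"
  assumes [measurable]: "f \<in> borel_measurable M" "g \<in> borel_measurable M"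
    and "integrable M (\<lambda>x. f x ^ 2)" "integrable M (\<lambda>x. g x ^ 2)"
  shows "integrable M (\<lambda>x. f x * g x)"
proof (rule Bochner_Integration.integrable_bound)
  show "integrable M (\<lambda>x. f x ^ 2 + g x ^ 2)" using assms by simp
  have "\<bar>f x * g x\<bar> \<le> f x ^ 2 + g x ^ 2" for x
  proof -
    have "2 * (\<bar>f x\<bar> * \<bar>g x\<bar>) \<le> f x ^ 2 + g x ^ 2" "0 \<le> \<bar>f x\<bar> * \<bar>g x\<bar>"
      using sum_squares_bound[of "\<bar>f x\<bar>" "\<bar>g x\<bar>"] by simp_all
    then show ?thesis unfolding abs_mult by linarith
  qed
  then show "AE x in M. norm (f x * g x) \<le> norm (f x ^ 2 + g x ^ 2)" by simp
qed simp

lemma centered_gaussian_vector_component: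
  assumes "centered_gaussian_vector Y I" "finite I" "i \<in> I"
  shows "centered_gaussian_rv (Y i)"
proof -
  have "centered_gaussian_rv (\<lambda>\<omega>. \<Sum>j\<in>I. (if j = i then 1 else 0) * Y j \<omega>)"
    using assms(1) unfolding centered_gaussian_vector_def by (rule spec)
  also have "(\<lambda>\<omega>. \<Sum>j\<in>I. (if j = i then 1 else 0) * Y j \<omega>) = Y i"
  proof
    fix \<omega>
    have "(\<Sum>j\<in>I. (if j = i then 1 else 0) * Y j \<omega>) = (\<Sum>j\<in>I. if j = i then Y j \<omega> else 0)"
      by (intro sum.cong) auto
    then show "(\<Sum>j\<in>I. (if j = i then 1 else 0) * Y j \<omega>) = Y i \<omega>"
      using assms(2,3) by simp
  qed
  finally show ?thesis .
qed

text \<open>Without cross terms, the variance of a linear combination is the sum of the variances of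
  its terms, so the Gaussian characteristic function of the combination factorises and Kac's
  criterion applies.\<close>

lemma uncorrelated_gaussian_indep_vars:
  assumes Y: "centered_gaussian_vector Y I" and I: "finite I" "I \<noteq> {}"
    and uncorr: "\<And>i j. i \<in> I \<Longrightarrow> j \<in> I \<Longrightarrow> i \<noteq> j \<Longrightarrow> expectation (\<lambda>x. Y i x * Y j x) = 0"
  shows "indep_vars (\<lambda>_. borel) Y I"
proof (rule indep_vars_if_char_sum[OF I])
  note G = centered_gaussian_vector_component[OF Y I(1)]
  show rv: "random_variable borel (Y i)" if "i \<in> I" for i
    using G[OF that] by (rule centered_gaussian_rv_measurable)
  have int: "integrable M (\<lambda>x. Y i x * Y j x)" if "i \<in> I" "j \<in> I" for i j
    using that rv centered_gaussian_integrable_power[OF G, of _ 2] by (intro integrable_mult_square) auto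
  fix c :: "nat \<Rightarrow> real"
  have S: "centered_gaussian_rv (\<lambda>x. \<Sum>i\<in>I. c i * Y i x)"
    using Y unfolding centered_gaussian_vector_def by (rule spec)
  note [measurable] = centered_gaussian_rv_measurable[OF S]
  have "expectation (\<lambda>x. (\<Sum>i\<in>I. c i * Y i x) ^ 2)
      = expectation (\<lambda>x. \<Sum>i\<in>I. \<Sum>j\<in>I. (c i * c j) * (Y i x * Y j x))"
    by (intro Bochner_Integration.integral_cong refl) (simp add: power2_eq_square sum_product mult_ac)
  also have "\<dots> = (\<Sum>i\<in>I. \<Sum>j\<in>I. (c i * c j) * expectation (\<lambda>x. Y i x * Y j x))"
    using int by (simp add: Bochner_Integration.integral_sum)
  also have "\<dots> = (\<Sum>i\<in>I. \<Sum>j\<in>I. if i = j then (c i)\<^sup>2 * expectation (\<lambda>x. Y i x ^ 2) else 0)"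
    using uncorr by (intro sum.cong refl) (auto simp: power2_eq_square)
  also have "\<dots> = (\<Sum>i\<in>I. (c i)\<^sup>2 * expectation (\<lambda>x. Y i x ^ 2))"
    using I by (intro sum.cong refl) simp
  finally have var: "expectation (\<lambda>x. (\<Sum>i\<in>I. c i * Y i x) ^ 2) = (\<Sum>i\<in>I. (c i)\<^sup>2 * expectation (\<lambda>x. Y i x ^ 2))" .
  \<comment> \<open>The joint characteristic function at \<open>c\<close> is that of the single
    Gaussian variable with coefficients \<open>c\<close>, taken at frequency 1.\<close>
  have "(CLINT x|M. iexp (\<Sum>i\<in>I. c i * Y i x)) = char (distr M borel (\<lambda>x. \<Sum>i\<in>I. c i * Y i x)) 1"
    by (simp add: char_def integral_distr)
  also have "\<dots> = exp (\<Sum>i\<in>I. - expectation (\<lambda>x. Y i x ^ 2) * (c i)\<^sup>2 / 2)"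
    unfolding centered_gaussian_char[OF S] var by (simp add: sum_negf sum_divide_distrib mult.commute)
  also have "\<dots> = (\<Prod>i\<in>I. char (distr M borel (Y i)) (c i))"
    using I by (simp add: exp_sum centered_gaussian_char[OF G])
  finally show "(CLINT x|M. iexp (\<Sum>i\<in>I. c i * Y i x)) = (\<Prod>i\<in>I. char (distr M borel (Y i)) (c i))" .
qed

end

section \<open>The polynomial inequality\<close>

text \<open>\<open>w2, \<dots>, w5\<close> weigh the parts of degree \<open>4, \<dots>, 10\<close> in \<open>(A, B)\<close> of \<open>E[(X\<^sub>2 + A)\<^sup>6 (X\<^sub>3 + B)\<^sup>4]\<close>
  for standard Gaussians of correlation \<open>c\<close>.\<close>

definition tilted_moment :: "real \<Rightarrow> real \<Rightarrow> real \<Rightarrow> real \<Rightarrow> real \<Rightarrow> real \<Rightarrow> real \<Rightarrow> real" where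
  "tilted_moment w2 w3 w4 w5 A B c =
     (45 + 540*c^2 + 360*c^4)
     + (A^2 * (135 + 1080*c^2 + 360*c^4) + A*B * (1080*c + 1440*c^3) + B^2 * (90 + 540*c^2))
     + w2 * (A^4 * (45 + 180*c^2) + A^3*B * (720*c + 480*c^3) + A^2*B^2 * (270 + 1080*c^2)
             + A*B^3 * (360*c) + 15*B^4)
     + w3 * (3*A^6 + A^5*B * (72*c) + A^4*B^2 * (90 + 180*c^2) + A^3*B^3 * (240*c) + 45*A^2*B^4)
     + w4 * (6*A^6*B^2 + 24*c*A^5*B^3 + 15*A^4*B^4)
     + w5 * (A^6*B^4)"

text \<open>Twice the determinant of the correlation matrix, for \<open>A = a / \<surd>(h/2)\<close> and \<open>B = b / \<surd>(h/2)\<close>.\<close>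

definition gram_det :: "real \<Rightarrow> real \<Rightarrow> real \<Rightarrow> real \<Rightarrow> real" where
  "gram_det h A B c = 2 - 2*c^2 - h * (A^2 + B^2 - 2*A*B*c)"

text \<open>The certificates were found by semidefinite programming. For \<open>m \<ge> 4\<close> the weights and the
  determinant are polynomials in \<open>h = 1/m \<in> [0, 1/4]\<close> of degree at most four; the last five
  certificates treat their Bernstein coefficients on this interval, with a multiplier of the
  determinant that does not depend on \<open>h\<close>.\<close>

lemma tilted_moment_bound_1:
  "tilted_moment 0 0 0 0 A B c - 45
    \<ge> A^2 + B^2 + c^2 + (220*c^2) * gram_det 1 A B c"
proof -
  have "tilted_moment 0 0 0 0 A B c - 45
      - (A^2 + B^2 + c^2 + (220*c^2) * gram_det 1 A B c)
    = 800 * (c^2)^2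
      + 99 * c^2
      + 89 * (B + 256/89*A*c)^2
      + 15988/89 * (A*c)^2
      + 760 * (B*c + 71/190*A + 25/38*A*c^2)^2
      + 2648/95 * (A + 245/1324*A*c^2)^2
      + 19925/662 * (A*c^2)^2" (is "_ = ?S")
    unfolding tilted_moment_def gram_det_def by algebra
  moreover have "?S \<ge> 0"
    by (intro add_nonneg_nonneg mult_nonneg_nonneg zero_le_power2) simp_all
  ultimately show ?thesis by linarith
qed

text \<open>At \<open>h = 1/2\<close> the weights containing the factor \<open>1 - 2*h\<close>
  vanish. In all certificates the squares fall into four groups, according to how their monomials
  behave when two of \<open>A\<close>, \<open>B\<close>, \<open>c\<close> change sign; both
  \<open>tilted_moment\<close> and the multiplied determinant are invariant under these changes.
  Within a group the squares are triangular: each drops the leading monomial of the one before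
  it.\<close>

lemma tilted_moment_bound_2:
  "tilted_moment (1/2) 0 0 0 A B c - 45
    \<ge> A^2 + B^2 + c^2 + (8*B^2 + 240*A^2*c^2) * gram_det (1/2) A B c"
proof -
  have "tilted_moment (1/2) 0 0 0 A B c - 45
      - (A^2 + B^2 + c^2 + (8*B^2 + 240*A^2*c^2) * gram_det (1/2) A B c)
    = 360 * (c^2 + 31/180*B^2 + 59/45*A*B*c + 8/45*A^2)^2
      + 37/45 * (B^2 + 212/37*A*B*c + 89/37*A^2)^2
      + 524/37 * (A*B*c + 51/262*A^2)^2
      + 1527/262 * (A^2)^2
      + 539 * (c + 240/539*A*B + 123/539*A^2*c)^2
      + 3307/539 * (A*B + 14678/3307*A^2*c)^2
      + 201937/3307 * (A^2*c)^2
      + 73 * (B + 68/73*A*c)^2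
      + 194/73 * (A*c)^2
      + 432 * (B*c + 29/54*A + 31/54*A*c^2)^2
      + 254/27 * (A - 718/127*A*c^2)^2
      + 50412/127 * (A*c^2)^2" (is "_ = ?S")
    unfolding tilted_moment_def gram_det_def by algebra
  moreover have "?S \<ge> 0"
    by (intro add_nonneg_nonneg mult_nonneg_nonneg zero_le_power2) simp_all
  ultimately show ?thesis by linarith
qed

lemma tilted_moment_bound_3:
  "tilted_moment (2/3) (2/9) 0 0 A B c - 45
    \<ge> A^2 + B^2 + c^2 + (80*A^2*c^2 + 12*A^2*B^2 + 8*A^4) * gram_det (1/3) A B c"
proof -
  have "tilted_moment (2/3) (2/9) 0 0 A B c - 45
      - (A^2 + B^2 + c^2 + (80*A^2*c^2 + 12*A^2*B^2 + 8*A^4) * gram_det (1/3) A B c)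
    = 360 * (c^2 + 3/20*B^2 + 8/9*A*B*c + 7/45*A^2)^2
      + 19/10 * (B^2 - 14/19*A^2)^2
      + 776/9 * (A*B*c + 25/97*A^2)^2
      + 19517/5529 * (A^2)^2
      + 539 * (c + 278/539*A*B + 232/539*A^2*c)^2
      + 5722/539 * (A*B + 1709/2861*A^2*c)^2
      + 25918/8583 * (A^2*c)^2
      + 89 * (B + 46/89*A*c - 40/89*A^2*B)^2
      + 287/89 * (A*c - 118/287*A^2*B)^2
      + 2831/1722 * (A^2*B)^2
      + 432 * (B*c + 1/2*A + 25/27*A*c^2 + 1/6*A*B^2 + 5/18*A^2*B*c + 1/54*A^3)^2
      + 26 * (A - 83/52*A*c^2 - 1/13*A*B^2 - 2/13*A^2*B*c - 1/4*A^3)^2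
      + 234157/2808 * (A*c^2 + 4068/33451*A*B^2 + 44472/234157*A^2*B*c + 28691/234157*A^3)^2
      + 20502/33451 * (A*B^2 + 21724/30753*A^2*B*c + 7765/27336*A^3)^2
      + 1767916/645813 * (A^2*B*c + 30717/1767916*A^3)^2
      + 10945007/42429984 * (A^3)^2" (is "_ = ?S")
    unfolding tilted_moment_def gram_det_def by algebra
  moreover have "?S \<ge> 0"
    by (intro add_nonneg_nonneg mult_nonneg_nonneg zero_le_power2) simp_all
  ultimately show ?thesis by linarith
qed

text \<open>The limit of large \<open>m\<close>: all weights are one, and the determinant condition
  has become \<open>c^2 \<le> 1\<close>.\<close>

lemma tilted_moment_bound_bernstein_0:
  "tilted_moment 1 1 1 1 A B c - 45
    \<ge> A^2 + B^2 + c^2 + (9/2 * (A^2*B - 5*A*c - 2*B)^2 + 6*B^2) * gram_det 0 A B c"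
proof -
  have "tilted_moment 1 1 1 1 A B c - 45
      - (A^2 + B^2 + c^2 + (9/2 * (A^2*B - 5*A*c - 2*B)^2 + 6*B^2) * gram_det 0 A B c)
    = 360 * (c^2 + 3/20*B^2 + 13/15*A*B*c + 7/36*A^2 + 1/15*A^2*B^2)^2
      + 69/10 * (B^2 - 8/69*A*B*c + 25/46*A^2 - 149/276*A^2*B^2)^2
      + 656/69 * (A*B*c + 61/328*A^2 + 53/656*A^2*B^2)^2
      + 1541/2952 * (A^2 - 9/134*A^2*B^2)^2
      + 87/268 * (A^2*B^2)^2
      + 539 * (c + 585/1078*A*B + 272/539*A^2*c + 34/539*A^3*B)^2
      + 29685/2156 * (A*B + 10447/19790*A^2*c - 36343/237480*A^3*B)^2
      + 459367/158320 * (A^2*c + 604539/1837468*A^3*B)^2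
      + 602927/2756202 * (A^3*B)^2
      + 41 * (B + 35/82*A*c - 23/82*A^2*B)^2
      + 32/41 * (A*c + 11/256*A^2*B)^2
      + 175/2048 * (A^2*B)^2
      + 480 * (B*c + 7/24*A + 83/80*A*c^2 + 67/240*A*B^2 + 119/240*A^2*B*c + 23/480*A^3 + 1/40*A^3*B^2)^2
      + 559/6 * (A - 1533/2236*A*c^2 + 23/86*A*B^2 + 799/1118*A^2*B*c + 181/2236*A^3 + 87/1118*A^3*B^2)^2
      + 2194173/89440 * (A*c^2 - 3406/43023*A*B^2 - 187094/731391*A^2*B*c - 20629/731391*A^3 - 42878/2194173*A^3*B^2)^2
      + 117499/114728 * (A*B^2 + 143909/117499*A^2*B*c + 116433/234998*A^3 + 59576/352497*A^3*B^2)^2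
      + 50057081/7989932 * (A^2*B*c + 22492473/100114162*A^3 + 12800242/150171243*A^3*B^2)^2
      + 140214123/200228324 * (A^3 + 71401354/420642369*A^3*B^2)^2
      + 39756583/1261927107 * (A^3*B^2)^2" (is "_ = ?S")
    unfolding tilted_moment_def gram_det_def by algebra
  moreover have "?S \<ge> 0"
    by (intro add_nonneg_nonneg mult_nonneg_nonneg zero_le_power2) simp_all
  ultimately show ?thesis by linarith
qed

text \<open>Beyond the first, the weights in this certificate and the next two are Bernstein
  coefficients and not values at \<open>h = 1/16\<close>, \<open>1/8\<close>, \<open>3/16\<close>.
  The first weight and the determinant are affine in \<open>h\<close>, so for them coefficients and
  values agree.\<close>

lemma tilted_moment_bound_bernstein_1:
  "tilted_moment (15/16) (13/16) (5/8) (3/8) A B c - 45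
    \<ge> A^2 + B^2 + c^2 + (9/2 * (A^2*B - 5*A*c - 2*B)^2 + 6*B^2) * gram_det (1/16) A B c"
proof -
  have "tilted_moment (15/16) (13/16) (5/8) (3/8) A B c - 45
      - (A^2 + B^2 + c^2 + (9/2 * (A^2*B - 5*A*c - 2*B)^2 + 6*B^2) * gram_det (1/16) A B c)
    = 360 * (c^2 + 7/45*B^2 + 8/9*A*B*c + 19/90*A^2 + 77/1440*A^2*B^2)^2
      + 4933/720 * (B^2 + 880/4933*A*B*c + 3368/4933*A^2 - 2381/4933*A^2*B^2)^2
      + 808029/157856 * (A*B*c + 32096/269343*A^2 + 75584/808029*A^2*B^2)^2
      + 541015/1436496 * (A^2 + 51136/1623045*A^2*B^2)^2
      + 29467519/207749760 * (A^2*B^2)^2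
      + 539 * (c + 513/1078*A*B + 222/539*A^2*c + 67/1078*A^3*B)^2
      + 6299/539 * (A*B + 4503/6299*A^2*c - 747933/6450176*A^3*B)^2
      + 1083011/201568 * (A^2*c + 7552897/34656352*A^3*B)^2
      + 325725189837/1135619342336 * (A^3*B)^2
      + 41 * (B + 27/82*A*c - 33/656*A^2*B)^2
      + 241/656 * (A*c + 183/964*A^2*B)^2
      + 10387/123392 * (A^2*B)^2
      + 476 * (B*c + 45/119*A + 35/34*A*c^2 + 1905/7616*A*B^2 + 54/119*A^2*B*c + 33/476*A^3 + 79/3808*A^3*B^2)^2
      + 7846/119 * (A - 221627/251072*A*c^2 + 36131/125536*A*B^2 + 416909/502144*A^2*B*c - 585/31384*A^3 + 6099/125536*A^3*B^2)^2
      + 234709649/8034304 * (A*c^2 + 1498670/234709649*A*B^2 - 17078983/469419298*A^2*B*c + 11605976/234709649*A^3 - 705842/234709649*A^3*B^2)^2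
      + 196694005353/240342680576 * (A*B^2 + 136249981264/196694005353*A^2*B*c + 7223423536/65564668451*A^3 + 7317907870/196694005353*A^3*B^2)^2
      + 15594013224869/6294208171296 * (A^2*B*c - 758824562829/15594013224869*A^3 + 338888104211/15594013224869*A^3*B^2)^2
      + 19733611183621/499008423195808 * (A^3 + 1849952093547/19733611183621*A^3*B^2)^2
      + 1830437639681/157868889468968 * (A^3*B^2)^2" (is "_ = ?S")
    unfolding tilted_moment_def gram_det_def by algebra
  moreover have "?S \<ge> 0"
    by (intro add_nonneg_nonneg mult_nonneg_nonneg zero_le_power2) simp_all
  ultimately show ?thesis by linarith
qed

lemma tilted_moment_bound_bernstein_2:
  "tilted_moment (7/8) (31/48) (35/96) (11/96) A B c - 45
    \<ge> A^2 + B^2 + c^2 + (9/2 * (A^2*B - 5*A*c - 2*B)^2 + 6*B^2) * gram_det (1/8) A B c"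
proof -
  have "tilted_moment (7/8) (31/48) (35/96) (11/96) A B c - 45
      - (A^2 + B^2 + c^2 + (9/2 * (A^2*B - 5*A*c - 2*B)^2 + 6*B^2) * gram_det (1/8) A B c)
    = 360 * (c^2 + 121/720*B^2 + 53/60*A*B*c + 29/144*A^2 + 23/480*A^2*B^2)^2
      + 8579/1440 * (B^2 + 2244/8579*A*B*c + 6215/8579*A^2 - 9159/17158*A^2*B^2)^2
      + 515411/137264 * (A*B*c + 45216/515411*A^2 + 64424/515411*A^2*B^2)^2
      + 760189/2061644 * (A^2 - 968989/3040756*A^2*B^2)^2
      + 4790841/48652096 * (A^2*B^2)^2
      + 539 * (c + 477/1078*A*B + 18/49*A^2*c + 61/1078*A^3*B)^2
      + 291031/17248 * (A*B + 29040/22387*A^2*c - 177833/2328248*A^3*B)^2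
      + 1588731/358192 * (A^2*c + 70769/529577*A^3*B)^2
      + 3783562183/14099458048 * (A^3*B)^2
      + 41 * (B + 25/82*A*c + 139/2624*A^2*B)^2
      + 329/656 * (A*c + 73/329*A^2*B)^2
      + 222279/1347584 * (A^2*B)^2
      + 467 * (B*c + 199/467*A + 492/467*A*c^2 + 841/3736*A*B^2 + 194/467*A^2*B*c + 233/3736*A^3 + 177/14944*A^3*B^2)^2
      + 22977/467 * (A - 819071/735264*A*c^2 + 48395/183816*A*B^2 + 2842855/2941056*A^2*B*c - 278/7659*A^3 + 5093/163392*A^3*B^2)^2
      + 131877541/23528448 * (A*c^2 + 4176476/131877541*A*B^2 - 44106653/527510164*A^2*B*c + 7680192/131877541*A^3 + 285921/263755082*A^3*B^2)^2
      + 2486092001/8440162624 * (A*B^2 + 2989060778/2486092001*A^2*B*c - 22353625/2486092001*A^3 + 241787737/9944368004*A^3*B^2)^2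
      + 97336059335/79554944032 * (A^2*B*c - 2372439393/97336059335*A^3 + 1540227471/77868847468*A^3*B^2)^2
      + 113697501621/3114753898720 * (A^3 + 826057225/454790006484*A^3*B^2)^2
      + 17658911593/29106560414976 * (A^3*B^2)^2" (is "_ = ?S")
    unfolding tilted_moment_def gram_det_def by algebra
  moreover have "?S \<ge> 0"
    by (intro add_nonneg_nonneg mult_nonneg_nonneg zero_le_power2) simp_all
  ultimately show ?thesis by linarith
qed

lemma tilted_moment_bound_bernstein_3:
  "tilted_moment (13/16) (1/2) (25/128) (3/128) A B c - 45
    \<ge> A^2 + B^2 + c^2 + (9/2 * (A^2*B - 5*A*c - 2*B)^2 + 6*B^2) * gram_det (3/16) A B c"
proof -
  have "tilted_moment (13/16) (1/2) (25/128) (3/128) A B c - 45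
      - (A^2 + B^2 + c^2 + (9/2 * (A^2*B - 5*A*c - 2*B)^2 + 6*B^2) * gram_det (3/16) A B c)
    = 360 * (c^2 + 29/180*B^2 + 8/9*A*B*c + 77/360*A^2 + 1/45*A^2*B^2)^2
      + 5287/720 * (B^2 + 1040/5287*A*B*c + 2588/5287*A^2 - 2863/5287*A^2*B^2)^2
      + 1034589/169184 * (A*B*c - 8544/344863*A^2 + 71240/1034589*A^2*B^2)^2
      + 1819841/5517808 * (A^2 - 23320/1819841*A^2*B^2)^2
      + 81380143/698818944 * (A^2*B^2)^2
      + 539 * (c + 228/539*A*B + 180/539*A^2*c + 113/2156*A^3*B)^2
      + 138995/8624 * (A*B + 223008/138995*A^2*c - 224319/2223920*A^3*B)^2
      + 34441553/4447840 * (A^2*c - 198289/34441553*A^3*B)^2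
      + 30811901215/141072601088 * (A^3*B)^2
      + 41 * (B + 51/164*A*c + 53/1312*A^2*B)^2
      + 49/82 * (A*c + 659/3136*A^2*B)^2
      + 78583/401408 * (A^2*B)^2
      + 472 * (B*c + 837/1888*A + 245/236*A*c^2 + 1555/7552*A*B^2 + 22/59*A^2*B*c + 25/472*A^3 + 17/3776*A^3*B^2)^2
      + 311399/7552 * (A - 370132/311399*A*c^2 + 390113/1245596*A*B^2 + 324898/311399*A^2*B*c - 15732/311399*A^3 + 9843/622798*A^3*B^2)^2
      + 44987049/2491192 * (A*c^2 - 21676199/719792784*A*B^2 - 8868253/59982732*A^2*B*c + 1421347/44987049*A^3 - 374959/119965464*A^3*B^2)^2
      + 39387446809/92133476352 * (A*B^2 + 44904688764/39387446809*A^2*B*c + 2024234032/39387446809*A^3 + 468536646/39387446809*A^3*B^2)^2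
      + 2093620235915/1260398297888 * (A^2*B*c - 112512818304/2093620235915*A^3 + 17081828726/2093620235915*A^3*B^2)^2
      + 195346703361/4187240471830 * (A^3 - 1294480421779/50008756060416*A^3*B^2)^2
      + 81736213195429/25604483102932992 * (A^3*B^2)^2" (is "_ = ?S")
    unfolding tilted_moment_def gram_det_def by algebra
  moreover have "?S \<ge> 0"
    by (intro add_nonneg_nonneg mult_nonneg_nonneg zero_le_power2) simp_all
  ultimately show ?thesis by linarith
qed

text \<open>The last Bernstein coefficient is the value at the endpoint \<open>h = 1/4\<close>,
  where the weight of \<open>A^6*B^4\<close> is zero; hence no square contains
  \<open>A^3*B^2\<close>.\<close>

lemma tilted_moment_bound_bernstein_4:
  "tilted_moment (3/4) (3/8) (3/32) 0 A B c - 45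
    \<ge> A^2 + B^2 + c^2 + (9/2 * (A^2*B - 5*A*c - 2*B)^2 + 6*B^2) * gram_det (1/4) A B c"
proof -
  have "tilted_moment (3/4) (3/8) (3/32) 0 A B c - 45
      - (A^2 + B^2 + c^2 + (9/2 * (A^2*B - 5*A*c - 2*B)^2 + 6*B^2) * gram_det (1/4) A B c)
    = 360 * (c^2 + 1/6*B^2 + 8/9*A*B*c + 19/90*A^2 + 1/120*A^2*B^2)^2
      + 29/4 * (B^2 + 8/87*A*B*c + 34/87*A^2 - 17/29*A^2*B^2)^2
      + 7391/696 * (A*B*c + 80/389*A^2 + 156/7391*A^2*B^2)^2
      + 15151/23340 * (A^2 - 432/15151*A^2*B^2)^2
      + 88545/9211808 * (A^2*B^2)^2
      + 539 * (c + 32/77*A*B + 172/539*A^2*c + 24/539*A^3*B)^2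
      + 361/22 * (A*B + 4392/2527*A^2*c - 685/5054*A^3*B)^2
      + 1226977/141512 * (A^2*c - 94559/1226977*A^3*B)^2
      + 5220483/19631632 * (A^3*B)^2
      + 41 * (B + 13/41*A*c + 1/41*A^2*B)^2
      + 165/328 * (A*c + 79/330*A^2*B)^2
      + 1039/5280 * (A^2*B)^2
      + 468 * (B*c + 71/156*A + 245/234*A*c^2 + 115/624*A*B^2 + 38/117*A^2*B*c + 43/936*A^3)^2
      + 1927/52 * (A - 28595/23124*A*c^2 + 2443/7708*A*B^2 + 25667/23124*A^2*B*c - 635/11562*A^3)^2
      + 16980595/1109952 * (A*c^2 + 243687/16980595*A*B^2 - 311999/3396119*A^2*B*c - 6098/3396119*A^3)^2
      + 275878977/1086758080 * (A*B^2 + 125162200/91959659*A^2*B*c - 72687130/275878977*A^3)^2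
      + 1242042017/367838636 * (A^2*B*c + 42184480/1242042017*A^3)^2
      + 117468583/29809008408 * (A^3)^2" (is "_ = ?S")
    unfolding tilted_moment_def gram_det_def by algebra
  moreover have "?S \<ge> 0"
    by (intro add_nonneg_nonneg mult_nonneg_nonneg zero_le_power2) simp_all
  ultimately show ?thesis by linarith
qed

text \<open>The five certificates are averaged with the Bernstein polynomials of degree four in
  \<open>t = 4*h\<close>, which are nonnegative on [0, 1] and sum to one. As the multiplier \<sigma>
  is common to all five, their determinant terms combine into a single multiple of
  \<open>gram_det h A B c\<close>.\<close>

lemma tilted_moment_bound_bernstein:
  fixes h A B c :: real
  assumes h: "0 \<le> h" "h \<le> 1/4" and g: "gram_det h A B c \<ge> 0"
  shows "tilted_moment (1 - h) ((1 - h) * (1 - 2*h)) ((1 - h) * (1 - 2*h) * (1 - 3*h))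
      ((1 - h) * (1 - 2*h) * (1 - 3*h) * (1 - 4*h)) A B c \<ge> 45 + A^2 + B^2 + c^2"
proof -
  define t where "t = 4 * h"
  have t: "0 \<le> t" "0 \<le> 1 - t" and ht: "h = t / 4" using h by (simp_all add: t_def)
  define \<sigma> where "\<sigma> = 9/2 * (A^2*B - 5*A*c - 2*B)^2 + 6*B^2"
  define N where "N = A^2 + B^2 + c^2"
  define P where "P w2 w3 w4 w5 = tilted_moment w2 w3 w4 w5 A B c - 45" for w2 w3 w4 w5
  have \<sigma>: "\<sigma> \<ge> 0" unfolding \<sigma>_def by simp
  let ?b0 = "(1 - t)^4" and ?b1 = "4 * t * (1 - t)^3" and ?b2 = "6 * t^2 * (1 - t)^2"
    and ?b3 = "4 * t^3 * (1 - t)" and ?b4 = "t^4"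
  \<comment> \<open>\<open>P\<close> is affine in the weights, so the Bernstein expansions of the
    weights carry over to it.\<close>
  have "P (1 - h) ((1 - h) * (1 - 2*h)) ((1 - h) * (1 - 2*h) * (1 - 3*h))
      ((1 - h) * (1 - 2*h) * (1 - 3*h) * (1 - 4*h))
    = ?b0 * P 1 1 1 1 + ?b1 * P (15/16) (13/16) (5/8) (3/8) + ?b2 * P (7/8) (31/48) (35/96) (11/96)
      + ?b3 * P (13/16) (1/2) (25/128) (3/128) + ?b4 * P (3/4) (3/8) (3/32) 0"
    unfolding P_def tilted_moment_def ht by algebra
  also have "\<dots> \<ge> ?b0 * (N + \<sigma> * gram_det 0 A B c) + ?b1 * (N + \<sigma> * gram_det (1/16) A B c)
      + ?b2 * (N + \<sigma> * gram_det (1/8) A B c) + ?b3 * (N + \<sigma> * gram_det (3/16) A B c)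
      + ?b4 * (N + \<sigma> * gram_det (1/4) A B c)"
    unfolding P_def N_def \<sigma>_def
    using t tilted_moment_bound_bernstein_0[of A B c] tilted_moment_bound_bernstein_1[of A B c]
      tilted_moment_bound_bernstein_2[of A B c] tilted_moment_bound_bernstein_3[of A B c]
      tilted_moment_bound_bernstein_4[of A B c]
    by (intro add_mono mult_left_mono) simp_all
  \<comment> \<open>Bernstein averaging fixes the constant \<open>N\<close> and reproduces functions
    affine in \<open>h\<close>, such as \<open>gram_det\<close>.\<close>
  also have "?b0 * (N + \<sigma> * gram_det 0 A B c) + ?b1 * (N + \<sigma> * gram_det (1/16) A B c)
      + ?b2 * (N + \<sigma> * gram_det (1/8) A B c) + ?b3 * (N + \<sigma> * gram_det (3/16) A B c)
      + ?b4 * (N + \<sigma> * gram_det (1/4) A B c) = N + \<sigma> * gram_det h A B c"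
    unfolding gram_det_def ht by algebra
  finally show ?thesis
    using mult_nonneg_nonneg[OF \<sigma> g] by (simp add: P_def N_def)
qed

text \<open>Only \<open>m = 1, 2, 3\<close> have \<open>h > 1/4\<close>, and each of them has its
  own certificate. The excess \<open>A^2 + B^2 + c^2\<close> over 45 serves the equality
  case.\<close>

lemma tilted_moment_bound:
  fixes m :: nat and A B c :: real
  defines "h \<equiv> 1 / real m"
  assumes m: "m \<ge> 1" and g: "gram_det h A B c \<ge> 0"
  shows "tilted_moment (1 - h) ((1 - h) * (1 - 2*h)) ((1 - h) * (1 - 2*h) * (1 - 3*h))
      ((1 - h) * (1 - 2*h) * (1 - 3*h) * (1 - 4*h)) A B c \<ge> 45 + A^2 + B^2 + c^2"
proof -
  consider "m = 1" | "m = 2" | "m = 3" | "m \<ge> 4" using m by linarith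
  then show ?thesis
  proof cases
    case 1
    then have h: "h = 1" by (simp add: h_def)
    have "(220*c^2) * gram_det h A B c \<ge> 0" using g by simp
    then show ?thesis using tilted_moment_bound_1[of A B c] by (simp add: h)
  next
    case 2
    then have h: "h = 1/2" by (simp add: h_def)
    have "(8*B^2 + 240*A^2*c^2) * gram_det h A B c \<ge> 0" using g by simp
    then show ?thesis using tilted_moment_bound_2[of A B c] by (simp add: h)
  next
    case 3
    then have h: "h = 1/3" by (simp add: h_def)
    have "(80*A^2*c^2 + 12*A^2*B^2 + 8*A^4) * gram_det h A B c \<ge> 0" using g by simp
    then show ?thesis using tilted_moment_bound_3[of A B c] by (simp add: h)
  next
    case 4
    then have "h \<le> 1/4" "0 \<le> h" by (simp_all add: h_def divide_simps)
    then show ?thesis using g by (intro tilted_moment_bound_bernstein)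
  qed
qed

section \<open>The mixed moment as a polynomial in the correlations\<close>

text \<open>The part of degree \<open>2*j\<close> in \<open>(A, B)\<close> acquires the factor
  \<open>(2*n)^j\<close>, which clears the denominators of its weight and leaves \<open>2^j\<close>
  times the falling factorial \<open>n*(n-1)*...*(n-j+1)\<close>. For \<open>n = m\<close> this is
  the ratio of the expectation of \<open>X^(2*m)\<close> times the Hermite polynomial of degree
  \<open>2*j\<close> to the expectation of \<open>X^(2*m)\<close>, for a standard Gaussian
  \<open>X\<close>.\<close>

lemma tilted_moment_scaled:
  fixes a b c n :: real
  assumes "n > 0"
  shows "tilted_moment (1 - 1/n) ((1 - 1/n) * (1 - 2/n)) ((1 - 1/n) * (1 - 2/n) * (1 - 3/n))
      ((1 - 1/n) * (1 - 2/n) * (1 - 3/n) * (1 - 4/n)) (sqrt (2*n) * a) (sqrt (2*n) * b) c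
    = (45 + 540*c^2 + 360*c^4)
     + 2*n * (a^2 * (135 + 1080*c^2 + 360*c^4) + a*b * (1080*c + 1440*c^3) + b^2 * (90 + 540*c^2))
     + 4*n*(n-1) * (a^4 * (45 + 180*c^2) + a^3*b * (720*c + 480*c^3) + a^2*b^2 * (270 + 1080*c^2)
             + a*b^3 * (360*c) + 15*b^4)
     + 8*n*(n-1)*(n-2) * (3*a^6 + a^5*b * (72*c) + a^4*b^2 * (90 + 180*c^2) + a^3*b^3 * (240*c) + 45*a^2*b^4)
     + 16*n*(n-1)*(n-2)*(n-3) * (6*a^6*b^2 + 24*c*a^5*b^3 + 15*a^4*b^4)
     + 32*n*(n-1)*(n-2)*(n-3)*(n-4) * (a^6*b^4)"
proof -
  define s where "s = sqrt (2*n)"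
  have s: "s^2 = 2*n" using assms by (simp add: s_def)
  have s4: "s^4 = 4*n^2" and s6: "s^6 = 8*n^3" and s8: "s^8 = 16*n^4" and s10: "s^10 = 32*n^5"
    using s by algebra+
  have t: "(1 - x/n) = (n - x)/n" for x using assms by (simp add: field_simps)
  \<comment> \<open>Every monomial has even total degree in \<open>(A, B)\<close>, so only even
    powers of the square root \<open>s\<close> appear.\<close>
  have "tilted_moment w2 w3 w4 w5 (s * a) (s * b) c
    = (45 + 540*c^2 + 360*c^4)
     + s^2 * (a^2 * (135 + 1080*c^2 + 360*c^4) + a*b * (1080*c + 1440*c^3) + b^2 * (90 + 540*c^2))
     + (w2 * s^4) * (a^4 * (45 + 180*c^2) + a^3*b * (720*c + 480*c^3) + a^2*b^2 * (270 + 1080*c^2)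
             + a*b^3 * (360*c) + 15*b^4)
     + (w3 * s^6) * (3*a^6 + a^5*b * (72*c) + a^4*b^2 * (90 + 180*c^2) + a^3*b^3 * (240*c) + 45*a^2*b^4)
     + (w4 * s^8) * (6*a^6*b^2 + 24*c*a^5*b^3 + 15*a^4*b^4)
     + (w5 * s^10) * (a^6*b^4)" for w2 w3 w4 w5
    unfolding tilted_moment_def by algebra
  moreover have "(1 - 1/n) * s^4 = 4*n*(n-1)"
      "((1 - 1/n) * (1 - 2/n)) * s^6 = 8*n*(n-1)*(n-2)"
      "((1 - 1/n) * (1 - 2/n) * (1 - 3/n)) * s^8 = 16*n*(n-1)*(n-2)*(n-3)"
      "((1 - 1/n) * (1 - 2/n) * (1 - 3/n) * (1 - 4/n)) * s^10 = 32*n*(n-1)*(n-2)*(n-3)*(n-4)"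
    unfolding s4 s6 s8 s10 t using assms by (simp_all add: power2_eq_square eval_nat_numeral)
  ultimately show ?thesis unfolding s_def[symmetric] s by simp
qed

text \<open>The sum is the expansion of \<open>X1^(2*m) * (a*X1 + U)^6 * (b*X1 + d*U + T)^4\<close>
  for independent \<open>X1\<close>, \<open>U\<close>, \<open>T\<close>, with \<open>n = m\<close>.
  Here \<open>p k\<close> stands for the moment of \<open>X1\<close> of order
  \<open>2*m + k\<close>, so that \<mu> is that of order \<open>2*m\<close>, and \<open>q\<close>,
  \<open>r\<close> are the moments of \<open>U\<close>, \<open>T\<close>, whose variances are
  \<open>u\<close>, \<open>v\<close>. Eliminating \<open>u\<close>, \<open>v\<close>,
  \<open>c\<close> leaves a polynomial identity in \<open>a\<close>, \<open>b\<close>,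
  \<open>d\<close>, \<open>n\<close>, \<mu>; nothing is divided by \<open>u\<close> or
  \<open>v\<close>, which may be zero.\<close>

lemma tilted_moment_expansion:
  fixes a b c d n u v \<mu> :: real and p q r :: "nat \<Rightarrow> real"
  assumes u: "a^2 + u = 1" and v: "b^2 + d^2 * u + v = 1" and c: "c = a * b + d * u"
    and p: "p 0 = \<mu>" "p 2 = \<mu> * (2*n+1)" "p 4 = \<mu> * ((2*n+1)*(2*n+3))"
        "p 6 = \<mu> * ((2*n+1)*(2*n+3)*(2*n+5))" "p 8 = \<mu> * ((2*n+1)*(2*n+3)*(2*n+5)*(2*n+7))"
        "p 10 = \<mu> * ((2*n+1)*(2*n+3)*(2*n+5)*(2*n+7)*(2*n+9))"
    and q: "q 0 = 1" "q 2 = u" "q 4 = 3*u^2" "q 6 = 15*u^3" "q 8 = 105*u^4" "q 10 = 945*u^5"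
    and r: "r 0 = 1" "r 2 = v" "r 4 = 3 * v^2"
    and odd: "\<And>k. odd k \<Longrightarrow> p k = 0" "\<And>k. odd k \<Longrightarrow> q k = 0" "\<And>k. odd k \<Longrightarrow> r k = 0"
  shows "(\<Sum>i\<le>6. \<Sum>j\<le>4. \<Sum>k\<le>j. of_nat (6 choose i) * of_nat (4 choose j) * of_nat (j choose k)
       * a^i * b^k * d^(j-k) * (p (i+k) * q ((6-i) + (j-k)) * r (4-j)))
    = \<mu> * ((45 + 540*c^2 + 360*c^4)
     + 2*n * (a^2 * (135 + 1080*c^2 + 360*c^4) + a*b * (1080*c + 1440*c^3) + b^2 * (90 + 540*c^2))
     + 4*n*(n-1) * (a^4 * (45 + 180*c^2) + a^3*b * (720*c + 480*c^3) + a^2*b^2 * (270 + 1080*c^2)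
             + a*b^3 * (360*c) + 15*b^4)
     + 8*n*(n-1)*(n-2) * (3*a^6 + a^5*b * (72*c) + a^4*b^2 * (90 + 180*c^2) + a^3*b^3 * (240*c) + 45*a^2*b^4)
     + 16*n*(n-1)*(n-2)*(n-3) * (6*a^6*b^2 + 24*c*a^5*b^3 + 15*a^4*b^4)
     + 32*n*(n-1)*(n-2)*(n-3)*(n-4) * (a^6*b^4))"
proof -
  have u': "u = 1 - a^2" using u by simp
  have v': "v = 1 - b^2 - d^2 * (1 - a^2)" using v unfolding u' by simp
  have six: "{..6::nat} = {0,1,2,3,4,5,6}" and four: "{..4::nat} = {0,1,2,3,4}"
    and three: "{..3::nat} = {0,1,2,3}" and two: "{..2::nat} = {0,1,2}" by auto
  have ch: "6 choose 2 = 15" "6 choose 3 = 20" "6 choose 4 = 15" "6 choose 5 = 6" 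
     "4 choose 2 = 6" "4 choose 3 = 4" "3 choose 2 = (3::nat)" by (simp_all add: eval_nat_numeral)
  have Suc2: "p (Suc (Suc 0)) = p 2" "q (Suc (Suc 0)) = q 2" "r (Suc (Suc 0)) = r 2"
    by (simp_all add: numeral_2_eq_2)
  show ?thesis
    by (simp add: six four three two ch Suc2 p q r odd, unfold c u' v') algebra
qed

section \<open>Gram-Schmidt orthogonalisation of a Gaussian triple and its mixed moment\<close>

context prob_space
begin

text \<open>This is the recursion that integration by parts would give, read off here from the
  closed formula; for odd \<open>k\<close> both sides vanish. It expresses the moments of order
  \<open>2*m + k\<close> through the one of order \<open>2*m\<close>.\<close>

lemma centered_gaussian_moment_Suc_Suc:
  assumes "centered_gaussian_rv Y"
  shows "expectation (\<lambda>x. Y x ^ (k + 2)) = real (k + 1) * expectation (\<lambda>x. Y x ^ 2) * expectation (\<lambda>x. Y x ^ k)"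
proof (cases "even k")
  case True
  then obtain l where k: "k = 2 * l" by (elim evenE)
  have "(fact (2 * Suc l) / (2 ^ Suc l * fact (Suc l)) :: real) = (2 * l + 1) * (fact (2 * l) / (2 ^ l * fact l))"
  proof -
    have "fact (2 * Suc l) = 2 * real (l + 1) * ((2 * l + 1) * fact (2 * l))"
      and "2 ^ Suc l * fact (Suc l) = 2 * real (l + 1) * (2 ^ l * fact l)"
      by (simp_all add: algebra_simps)
    then show ?thesis
      by (simp only: mult_divide_mult_cancel_left times_divide_eq_right) simp
  qed
  then show ?thesis
    using centered_gaussian_even_moment[OF assms, of l] centered_gaussian_even_moment[OF assms, of "Suc l"]
    by (simp add: k mult_ac)
next
  case False
  then show ?thesis
    using centered_gaussian_odd_moment[OF assms, of k] centered_gaussian_odd_moment[OF assms, of "k + 2"] by simp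
qed

lemma centered_gaussian_integrable_mult:
  assumes "centered_gaussian_rv Y" "centered_gaussian_rv Z"
  shows "integrable M (\<lambda>x. Y x * Z x)"
  using assms by (intro integrable_mult_square centered_gaussian_rv_measurable centered_gaussian_integrable_power)

text \<open>Serves both the orthogonalised triple and, for the equality case, the original
  independent variables.\<close>

lemma indep_vars_moments:
  fixes Y :: "nat \<Rightarrow> 'a \<Rightarrow> real"
  assumes ind: "indep_vars (\<lambda>_. borel) Y {1, 2, 3}"
    and int: "\<And>i k. i \<in> {1, 2, 3} \<Longrightarrow> integrable M (\<lambda>x. Y i x ^ k)"
  shows "integrable M (\<lambda>x. Y 1 x ^ p * Y 2 x ^ q * Y 3 x ^ r)"
    and "expectation (\<lambda>x. Y 1 x ^ p * Y 2 x ^ q * Y 3 x ^ r)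
      = expectation (\<lambda>x. Y 1 x ^ p) * expectation (\<lambda>x. Y 2 x ^ q) * expectation (\<lambda>x. Y 3 x ^ r)"
proof -
  define e where "e i = (if i = 1 then p else if i = 2 then q else r)" for i :: nat
  have ind': "indep_vars (\<lambda>_. borel) (\<lambda>i x. Y i x ^ e i) {1, 2, 3}"
    using indep_vars_compose2[OF ind, of "\<lambda>i y. y ^ e i" "\<lambda>_. borel"] by simp
  have int': "integrable M (\<lambda>x. Y i x ^ e i)" if "i \<in> {1, 2, 3}" for i using int[OF that] .
  show "integrable M (\<lambda>x. Y 1 x ^ p * Y 2 x ^ q * Y 3 x ^ r)"
    using indep_vars_integrable[OF _ ind' int'] by (simp add: e_def mult.assoc)
  show "expectation (\<lambda>x. Y 1 x ^ p * Y 2 x ^ q * Y 3 x ^ r)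
      = expectation (\<lambda>x. Y 1 x ^ p) * expectation (\<lambda>x. Y 2 x ^ q) * expectation (\<lambda>x. Y 3 x ^ r)"
    using indep_vars_lebesgue_integral[OF _ ind' int'] by (simp add: e_def mult.assoc)
qed

lemma centered_gaussian_vector_linear:
  assumes "centered_gaussian_vector X {1, 2, 3}"
  shows "centered_gaussian_rv (\<lambda>\<omega>. \<alpha> * X 1 \<omega> + \<beta> * X 2 \<omega> + \<gamma> * X 3 \<omega>)"
proof -
  define c where "c i = (if i = 1 then \<alpha> else if i = 2 then \<beta> else \<gamma>)" for i :: nat
  have "centered_gaussian_rv (\<lambda>\<omega>. \<Sum>i\<in>{1, 2, 3}. c i * X i \<omega>)"
    using assms unfolding centered_gaussian_vector_def by (rule spec)
  then show ?thesis by (simp add: c_def add.assoc)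
qed

text \<open>Gram--Schmidt: \<open>U\<close> and \<open>T\<close> are the successive residuals. If \<open>U\<close> vanishes almost surely,
  any \<open>d\<close> will do.\<close>

lemma gaussian_triple_decomposition:
  fixes X :: "nat \<Rightarrow> 'a \<Rightarrow> real"
  assumes G: "centered_gaussian_vector X {1, 2, 3}"
    and unit: "\<And>i. i \<in> {1, 2, 3} \<Longrightarrow> expectation (\<lambda>\<omega>. X i \<omega> ^ 2) = 1"
  defines "a \<equiv> expectation (\<lambda>\<omega>. X 1 \<omega> * X 2 \<omega>)" and "b \<equiv> expectation (\<lambda>\<omega>. X 1 \<omega> * X 3 \<omega>)"
    and "c \<equiv> expectation (\<lambda>\<omega>. X 2 \<omega> * X 3 \<omega>)"
  obtains d U T where "X 2 = (\<lambda>\<omega>. a * X 1 \<omega> + U \<omega>)" "X 3 = (\<lambda>\<omega>. b * X 1 \<omega> + d * U \<omega> + T \<omega>)"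
    "centered_gaussian_rv U" "centered_gaussian_rv T"
    "indep_vars (\<lambda>_. borel) (\<lambda>i. if i = 1 then X 1 else if i = 2 then U else T) {1, 2, 3 :: nat}"
    "a^2 + expectation (\<lambda>\<omega>. U \<omega> ^ 2) = 1"
    "b^2 + d^2 * expectation (\<lambda>\<omega>. U \<omega> ^ 2) + expectation (\<lambda>\<omega>. T \<omega> ^ 2) = 1"
    "c = a * b + d * expectation (\<lambda>\<omega>. U \<omega> ^ 2)"
proof -
  note lin = centered_gaussian_vector_linear[OF G]
  have X: "centered_gaussian_rv (X i)" if "i \<in> {1, 2, 3}" for i
    using centered_gaussian_vector_component[OF G _ that] by simp
  have int[simp]: "integrable M (\<lambda>\<omega>. X i \<omega> * X j \<omega>)" if "i \<in> {1, 2, 3}" "j \<in> {1, 2, 3}" for i j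
    using X that by (intro centered_gaussian_integrable_mult)
  have E[simp]: "expectation (\<lambda>\<omega>. X 1 \<omega> * X 1 \<omega>) = 1" "expectation (\<lambda>\<omega>. X 2 \<omega> * X 2 \<omega>) = 1"
      "expectation (\<lambda>\<omega>. X 3 \<omega> * X 3 \<omega>) = 1" "expectation (\<lambda>\<omega>. X 1 \<omega> * X 2 \<omega>) = a"
      "expectation (\<lambda>\<omega>. X 1 \<omega> * X 3 \<omega>) = b" "expectation (\<lambda>\<omega>. X 2 \<omega> * X 3 \<omega>) = c"
    using unit[of 1] unit[of 2] unit[of 3] by (simp_all add: a_def b_def c_def power2_eq_square)
  \<comment> \<open>All variables below are linear combinations of the \<open>X i\<close>, so every
    covariance is an instance of this bilinear form.\<close>
  have bil: "expectation (\<lambda>\<omega>. (\<alpha> * X 1 \<omega> + \<beta> * X 2 \<omega> + \<gamma> * X 3 \<omega>) * (\<alpha>' * X 1 \<omega> + \<beta>' * X 2 \<omega> + \<gamma>' * X 3 \<omega>))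
      = \<alpha> * \<alpha>' + \<beta> * \<beta>' + \<gamma> * \<gamma>' + (\<alpha> * \<beta>' + \<beta> * \<alpha>') * a + (\<alpha> * \<gamma>' + \<gamma> * \<alpha>') * b + (\<beta> * \<gamma>' + \<gamma> * \<beta>') * c"
    for \<alpha> \<beta> \<gamma> \<alpha>' \<beta>' \<gamma>'
  proof -
    have "(\<lambda>\<omega>. (\<alpha> * X 1 \<omega> + \<beta> * X 2 \<omega> + \<gamma> * X 3 \<omega>) * (\<alpha>' * X 1 \<omega> + \<beta>' * X 2 \<omega> + \<gamma>' * X 3 \<omega>))
      = (\<lambda>\<omega>. \<alpha> * \<alpha>' * (X 1 \<omega> * X 1 \<omega>) + \<beta> * \<beta>' * (X 2 \<omega> * X 2 \<omega>) + \<gamma> * \<gamma>' * (X 3 \<omega> * X 3 \<omega>)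
        + (\<alpha> * \<beta>' + \<beta> * \<alpha>') * (X 1 \<omega> * X 2 \<omega>) + (\<alpha> * \<gamma>' + \<gamma> * \<alpha>') * (X 1 \<omega> * X 3 \<omega>)
        + (\<beta> * \<gamma>' + \<gamma> * \<beta>') * (X 2 \<omega> * X 3 \<omega>))"
      by (rule ext) algebra
    then show ?thesis by (simp del: One_nat_def)
  qed
  define U where "U \<omega> = X 2 \<omega> - a * X 1 \<omega>" for \<omega>
  define u where "u = expectation (\<lambda>\<omega>. U \<omega> ^ 2)"
  have U: "U = (\<lambda>\<omega>. (- a) * X 1 \<omega> + 1 * X 2 \<omega> + 0 * X 3 \<omega>)" by (simp add: U_def fun_eq_iff)
  have u: "u = 1 - a^2"
    unfolding u_def power2_eq_square U bil by (simp add: algebra_simps)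
  have GU: "centered_gaussian_rv U" unfolding U by (rule lin)
  have UX3: "expectation (\<lambda>\<omega>. U \<omega> * X 3 \<omega>) = c - a * b"
    using bil[of "-a" 1 0 0 0 1] unfolding U by simp
  \<comment> \<open>The right-hand side is the expectation of \<open>U * X 3\<close>, so it vanishes
    together with \<open>u\<close>; the equation is solvable even then.\<close>
  have "\<exists>d. d * u = c - a * b"
  proof (cases "u = 0")
    case True
    then have "AE \<omega> in M. U \<omega> ^ 2 = 0"
      unfolding u_def using centered_gaussian_integrable_power[OF GU, of 2]
      by (subst (asm) integral_nonneg_eq_0_iff_AE) auto
    then have "expectation (\<lambda>\<omega>. U \<omega> * X 3 \<omega>) = expectation (\<lambda>\<omega>. 0)"
      using centered_gaussian_rv_measurable[OF GU] centered_gaussian_rv_measurable[OF X[of 3]]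
      by (intro integral_cong_AE) auto
    then show ?thesis using UX3 True by simp
  next
    case False
    then show ?thesis by (intro exI[of _ "(c - a * b) / u"]) simp
  qed
  then obtain d where d: "d * u = c - a * b" by blast
  define T where "T \<omega> = X 3 \<omega> - b * X 1 \<omega> - d * U \<omega>" for \<omega>
  have T: "T = (\<lambda>\<omega>. (d * a - b) * X 1 \<omega> + (- d) * X 2 \<omega> + 1 * X 3 \<omega>)"
    by (simp add: T_def U_def fun_eq_iff algebra_simps)
  have GT: "centered_gaussian_rv T" unfolding T by (rule lin)
  define Y where "Y i = (if i = 1 then X 1 else if i = 2 then U else T)" for i :: nat
  have XU: "expectation (\<lambda>\<omega>. X 1 \<omega> * U \<omega>) = 0"
    using bil[of 1 0 0 "-a" 1 0] unfolding U by simp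
  have XT: "expectation (\<lambda>\<omega>. X 1 \<omega> * T \<omega>) = 0"
    using bil[of 1 0 0 "d * a - b" "-d" 1] unfolding T by simp
  have UT: "expectation (\<lambda>\<omega>. U \<omega> * T \<omega>) = 0"
    using d unfolding U T bil u by (simp add: algebra_simps power2_eq_square)
  have ind: "indep_vars (\<lambda>_. borel) Y {1, 2, 3}"
  proof (rule uncorrelated_gaussian_indep_vars)
    show "centered_gaussian_vector Y {1, 2, 3}"
      unfolding centered_gaussian_vector_def
    proof
      fix e :: "nat \<Rightarrow> real"
      have "(\<lambda>\<omega>. \<Sum>i\<in>{1, 2, 3}. e i * Y i \<omega>) =
        (\<lambda>\<omega>. (e 1 - a * e 2 + (d * a - b) * e 3) * X 1 \<omega> + (e 2 - d * e 3) * X 2 \<omega> + e 3 * X 3 \<omega>)"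
        by (simp add: Y_def U T fun_eq_iff algebra_simps)
      then show "centered_gaussian_rv (\<lambda>\<omega>. \<Sum>i\<in>{1, 2, 3}. e i * Y i \<omega>)"
        using lin by (simp only:)
    qed
    show "expectation (\<lambda>\<omega>. Y i \<omega> * Y j \<omega>) = 0" if "i \<in> {1, 2, 3}" "j \<in> {1, 2, 3}" "i \<noteq> j" for i j
      using that XU XT UT by (auto simp: Y_def mult.commute)
  qed auto
  have v: "b^2 + d^2 * u + expectation (\<lambda>\<omega>. T \<omega> ^ 2) = 1"
  proof -
    have "expectation (\<lambda>\<omega>. T \<omega> ^ 2) = expectation (\<lambda>\<omega>. T \<omega> * T \<omega>)" by (simp add: power2_eq_square)
    then show ?thesis using d unfolding T bil u by algebra
  qed
  show thesis
  proof (rule that[of U d T])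
    show "X 2 = (\<lambda>\<omega>. a * X 1 \<omega> + U \<omega>)" by (simp add: U_def fun_eq_iff)
    show "X 3 = (\<lambda>\<omega>. b * X 1 \<omega> + d * U \<omega> + T \<omega>)" by (simp add: T_def fun_eq_iff)
    show "indep_vars (\<lambda>_. borel) (\<lambda>i. if i = 1 then X 1 else if i = 2 then U else T) {1, 2, 3 :: nat}"
      using ind by (simp add: Y_def[abs_def])
    show "a^2 + expectation (\<lambda>\<omega>. U \<omega> ^ 2) = 1" using u by (simp add: u_def)
    show "b^2 + d^2 * expectation (\<lambda>\<omega>. U \<omega> ^ 2) + expectation (\<lambda>\<omega>. T \<omega> ^ 2) = 1"
      using v by (simp add: u_def)
    show "c = a * b + d * expectation (\<lambda>\<omega>. U \<omega> ^ 2)" using d by (simp add: u_def)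
  qed (use GU GT in auto)
qed

text \<open>Expanding in the independent variables \<open>X 1\<close>, \<open>U\<close>,
  \<open>T\<close> reduces the mixed moment to products of one-dimensional moments. The determinant
  is nonnegative because it is twice the product of the two residual variances.\<close>

lemma unit_gaussian_triple_moment:
  fixes X :: "nat \<Rightarrow> 'a \<Rightarrow> real" and m :: nat
  assumes G: "centered_gaussian_vector X {1, 2, 3}"
    and unit: "\<And>i. i \<in> {1, 2, 3} \<Longrightarrow> expectation (\<lambda>\<omega>. X i \<omega> ^ 2) = 1" and m: "m \<ge> 1"
  defines "A \<equiv> sqrt (2 * m) * expectation (\<lambda>\<omega>. X 1 \<omega> * X 2 \<omega>)"
    and "B \<equiv> sqrt (2 * m) * expectation (\<lambda>\<omega>. X 1 \<omega> * X 3 \<omega>)"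
    and "c \<equiv> expectation (\<lambda>\<omega>. X 2 \<omega> * X 3 \<omega>)" and "h \<equiv> 1 / real m"
  shows "expectation (\<lambda>\<omega>. X 1 \<omega> ^ (2 * m) * X 2 \<omega> ^ 6 * X 3 \<omega> ^ 4)
      = expectation (\<lambda>\<omega>. X 1 \<omega> ^ (2 * m)) * tilted_moment (1 - h) ((1 - h) * (1 - 2*h))
          ((1 - h) * (1 - 2*h) * (1 - 3*h)) ((1 - h) * (1 - 2*h) * (1 - 3*h) * (1 - 4*h)) A B c"
    and "gram_det h A B c \<ge> 0"
proof -
  define a where "a = expectation (\<lambda>\<omega>. X 1 \<omega> * X 2 \<omega>)"
  define b where "b = expectation (\<lambda>\<omega>. X 1 \<omega> * X 3 \<omega>)"
  define n where "n = real m"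
  have n: "n > 0" using m by (simp add: n_def)
  obtain d U T where X2: "X 2 = (\<lambda>\<omega>. a * X 1 \<omega> + U \<omega>)" and X3: "X 3 = (\<lambda>\<omega>. b * X 1 \<omega> + d * U \<omega> + T \<omega>)"
    and GU: "centered_gaussian_rv U" and GT: "centered_gaussian_rv T"
    and ind: "indep_vars (\<lambda>_. borel) (\<lambda>i. if i = 1 then X 1 else if i = 2 then U else T) {1, 2, 3 :: nat}"
    and u: "a^2 + expectation (\<lambda>\<omega>. U \<omega> ^ 2) = 1"
    and v: "b^2 + d^2 * expectation (\<lambda>\<omega>. U \<omega> ^ 2) + expectation (\<lambda>\<omega>. T \<omega> ^ 2) = 1"
    and c: "c = a * b + d * expectation (\<lambda>\<omega>. U \<omega> ^ 2)"
    by (rule gaussian_triple_decomposition[OF G unit, folded a_def b_def c_def]) (assumption | rule that)+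
  have G1: "centered_gaussian_rv (X 1)"
    using centered_gaussian_vector_component[OF G, of 1] by simp
  define p where "p k = expectation (\<lambda>\<omega>. X 1 \<omega> ^ (2 * m + k))" for k
  define q where "q k = expectation (\<lambda>\<omega>. U \<omega> ^ k)" for k
  define r where "r k = expectation (\<lambda>\<omega>. T \<omega> ^ k)" for k
  have ints: "integrable M (\<lambda>\<omega>. (if i = 1 then X 1 else if i = 2 then U else T) \<omega> ^ k)" for i k :: nat
    using G1 GU GT by (simp add: centered_gaussian_integrable_power)
  note mom = indep_vars_moments[OF ind ints, simplified]
  \<comment> \<open>\<open>i\<close> is the exponent of \<open>X 1\<close> in the sixth power. In
    the fourth power, \<open>4-j\<close> is the exponent of \<open>T\<close>, and \<open>k\<close>
    and \<open>j-k\<close> are those of \<open>X 1\<close> and \<open>U\<close>.\<close>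
  define C where "C i j k = real (6 choose i) * real (4 choose j) * real (j choose k) * a^i * b^k * d^(j-k)" for i j k
  define F where "F i j k \<omega> = X 1 \<omega> ^ (2 * m + (i+k)) * U \<omega> ^ ((6-i) + (j-k)) * T \<omega> ^ (4-j)" for i j k \<omega>
  have F: "integrable M (F i j k)" "expectation (F i j k) = p (i+k) * q ((6-i) + (j-k)) * r (4-j)" for i j k
    unfolding F_def p_def q_def r_def using mom by (simp_all add: mult.assoc)
  have expand: "X 1 \<omega> ^ (2 * m) * X 2 \<omega> ^ 6 * X 3 \<omega> ^ 4 = (\<Sum>i\<le>6. \<Sum>j\<le>4. \<Sum>k\<le>j. C i j k * F i j k \<omega>)" for \<omega>
  proof -
    have 2: "X 2 \<omega> ^ 6 = (\<Sum>i\<le>6. real (6 choose i) * (a * X 1 \<omega>)^i * U \<omega>^(6-i))"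
      unfolding X2 by (rule binomial_ring)
    have 3: "X 3 \<omega> ^ 4 = (\<Sum>j\<le>4. \<Sum>k\<le>j. real (4 choose j)
        * (real (j choose k) * (b * X 1 \<omega>)^k * (d * U \<omega>)^(j-k)) * T \<omega>^(4-j))"
      unfolding X3 binomial_ring[of "b * X 1 \<omega> + d * U \<omega>" "T \<omega>"] binomial_ring[of "b * X 1 \<omega>" "d * U \<omega>"]
        sum_distrib_left sum_distrib_right ..
    show ?thesis
      unfolding 2 3 mult.assoc[of "X 1 \<omega> ^ (2 * m)"] sum_product
      unfolding sum_distrib_left
      by (intro sum.cong refl) (simp only: C_def F_def power_mult_distrib power_add mult_ac)
  qed
  have "expectation (\<lambda>\<omega>. X 1 \<omega> ^ (2 * m) * X 2 \<omega> ^ 6 * X 3 \<omega> ^ 4)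
      = (\<Sum>i\<le>6. \<Sum>j\<le>4. \<Sum>k\<le>j. C i j k * expectation (F i j k))"
    unfolding expand using F(1) by (simp add: Bochner_Integration.integral_sum)
  also have "\<dots> = p 0 * tilted_moment (1 - 1/n) ((1 - 1/n) * (1 - 2/n)) ((1 - 1/n) * (1 - 2/n) * (1 - 3/n))
      ((1 - 1/n) * (1 - 2/n) * (1 - 3/n) * (1 - 4/n)) (sqrt (2*n) * a) (sqrt (2*n) * b) c"
    unfolding tilted_moment_scaled[OF n] F(2) C_def
  proof (rule tilted_moment_expansion[OF u v c])
    have pS: "p (k + 2) = (2 * n + k + 1) * p k" for k
      using centered_gaussian_moment_Suc_Suc[OF G1, of "2 * m + k"] unit[of 1]
      by (simp add: p_def n_def add_ac)
    have p2: "p 2 = p 0 * (2*n+1)" using pS[of 0] by (simp add: numeral_2_eq_2 mult_ac)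
    show "p 0 = p 0" "p 2 = p 0 * (2*n+1)" "p 4 = p 0 * ((2*n+1)*(2*n+3))"
        "p 6 = p 0 * ((2*n+1)*(2*n+3)*(2*n+5))" "p 8 = p 0 * ((2*n+1)*(2*n+3)*(2*n+5)*(2*n+7))"
        "p 10 = p 0 * ((2*n+1)*(2*n+3)*(2*n+5)*(2*n+7)*(2*n+9))"
      using p2 pS[of 2] pS[of 4] pS[of 6] pS[of 8] by (simp_all add: add_ac mult_ac)
    have qS: "q (k + 2) = (k + 1) * expectation (\<lambda>\<omega>. U \<omega> ^ 2) * q k" for k
      using centered_gaussian_moment_Suc_Suc[OF GU, of k] by (simp add: q_def)
    have q0: "q 0 = 1" by (simp add: q_def prob_space)
    show "q 0 = 1" "q 2 = expectation (\<lambda>\<omega>. U \<omega> ^ 2)" "q 4 = 3 * expectation (\<lambda>\<omega>. U \<omega> ^ 2)^2"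
        "q 6 = 15 * expectation (\<lambda>\<omega>. U \<omega> ^ 2)^3" "q 8 = 105 * expectation (\<lambda>\<omega>. U \<omega> ^ 2)^4"
        "q 10 = 945 * expectation (\<lambda>\<omega>. U \<omega> ^ 2)^5"
      using q0 qS[of 0] qS[of 2] qS[of 4] qS[of 6] qS[of 8] by (simp_all add: eval_nat_numeral)
    have rS: "r (k + 2) = (k + 1) * expectation (\<lambda>\<omega>. T \<omega> ^ 2) * r k" for k
      using centered_gaussian_moment_Suc_Suc[OF GT, of k] by (simp add: r_def)
    have r0: "r 0 = 1" by (simp add: r_def prob_space)
    show "r 0 = 1" "r 2 = expectation (\<lambda>\<omega>. T \<omega> ^ 2)" "r 4 = 3 * expectation (\<lambda>\<omega>. T \<omega> ^ 2)^2"
      using r0 rS[of 0] rS[of 2] by (simp_all add: eval_nat_numeral)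
  qed (use centered_gaussian_odd_moment[OF G1] in
      \<open>simp_all add: p_def q_def r_def centered_gaussian_odd_moment GU GT\<close>)
  finally show "expectation (\<lambda>\<omega>. X 1 \<omega> ^ (2 * m) * X 2 \<omega> ^ 6 * X 3 \<omega> ^ 4)
      = expectation (\<lambda>\<omega>. X 1 \<omega> ^ (2 * m)) * tilted_moment (1 - h) ((1 - h) * (1 - 2*h))
          ((1 - h) * (1 - 2*h) * (1 - 3*h)) ((1 - h) * (1 - 2*h) * (1 - 3*h) * (1 - 4*h)) A B c"
    by (simp add: p_def n_def h_def A_def B_def a_def b_def)
  have "gram_det h A B c = 2 - 2*c^2 - (h * (2 * n)) * (a^2 + b^2 - 2*a*b*c)"
    unfolding gram_det_def A_def B_def a_def[symmetric] b_def[symmetric]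
    using n by (simp add: n_def power_mult_distrib algebra_simps)
  \<comment> \<open>The scaling of \<open>A\<close> and \<open>B\<close> by
    \<open>sqrt (2 * m)\<close> gives \<open>h * (2 * n) = 2\<close>.\<close>
  also have "\<dots> = 2 * (1 - c^2 - a^2 - b^2 + 2*a*b*c)"
    using n by (simp add: h_def n_def)
  also have "\<dots> = 2 * (expectation (\<lambda>\<omega>. U \<omega> ^ 2) * expectation (\<lambda>\<omega>. T \<omega> ^ 2))"
    using u v c by algebra
  also have "\<dots> \<ge> 0" by simp
  finally show "gram_det h A B c \<ge> 0" .
qed

end

section \<open>Reduction to unit variances and the equality case\<close>

theorem theorem4p1:
  fixes M :: "'a measure" and X :: "nat \<Rightarrow> 'a \<Rightarrow> real" and m :: nat
  assumes "prob_space M"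
    and "m \<ge> 1"
    and "prob_space.centered_gaussian_vector M X {1, 2, 3}"
    and "\<And>i. i \<in> {1, 2, 3} \<Longrightarrow> prob_space.variance M (X i) > 0"
  shows "prob_space.expectation M (\<lambda>\<omega>. X 1 \<omega> ^ (2 * m) * X 2 \<omega> ^ 6 * X 3 \<omega> ^ 4)
           \<ge> prob_space.expectation M (\<lambda>\<omega>. X 1 \<omega> ^ (2 * m))
             * prob_space.expectation M (\<lambda>\<omega>. X 2 \<omega> ^ 6)
             * prob_space.expectation M (\<lambda>\<omega>. X 3 \<omega> ^ 4)
     \<and> (prob_space.expectation M (\<lambda>\<omega>. X 1 \<omega> ^ (2 * m) * X 2 \<omega> ^ 6 * X 3 \<omega> ^ 4)
           = prob_space.expectation M (\<lambda>\<omega>. X 1 \<omega> ^ (2 * m))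
             * prob_space.expectation M (\<lambda>\<omega>. X 2 \<omega> ^ 6)
             * prob_space.expectation M (\<lambda>\<omega>. X 3 \<omega> ^ 4)
         \<longleftrightarrow> prob_space.indep_vars M (\<lambda>_. borel) X {1, 2, 3})"
proof -
  interpret prob_space M by fact
  note G = assms(3)
  have X: "centered_gaussian_rv (X i)" if "i \<in> {1, 2, 3}" for i
    using centered_gaussian_vector_component[OF G _ that] by simp
  have int: "integrable M (\<lambda>\<omega>. X i \<omega> ^ k)" if "i \<in> {1, 2, 3}" for i k
    using X[OF that] by (rule centered_gaussian_integrable_power)
  define s where "s i = sqrt (expectation (\<lambda>\<omega>. X i \<omega> ^ 2))" for i
  \<comment> \<open>The means are zero, so the variances are the second moments.\<close>
  have s: "s i > 0" "s i ^ 2 = expectation (\<lambda>\<omega>. X i \<omega> ^ 2)" if "i \<in> {1, 2, 3}" for i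
    using assms(4)[OF that] centered_gaussian_odd_moment[OF X[OF that], of 1] by (simp_all add: s_def)
  define Z where "Z i \<omega> = X i \<omega> / s i" for i \<omega>
  have XZ: "X i \<omega> = s i * Z i \<omega>" if "i \<in> {1, 2, 3}" for i \<omega>
    using s(1)[OF that] by (simp add: Z_def)
  have GZ: "centered_gaussian_vector Z {1, 2, 3}"
    unfolding centered_gaussian_vector_def
  proof
    fix e :: "nat \<Rightarrow> real"
    have "centered_gaussian_rv (\<lambda>\<omega>. \<Sum>i\<in>{1, 2, 3}. (e i / s i) * X i \<omega>)"
      using G unfolding centered_gaussian_vector_def by (rule spec)
    then show "centered_gaussian_rv (\<lambda>\<omega>. \<Sum>i\<in>{1, 2, 3}. e i * Z i \<omega>)"
      by (simp add: Z_def)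
  qed
  have Z: "centered_gaussian_rv (Z i)" if "i \<in> {1, 2, 3}" for i
    using centered_gaussian_vector_component[OF GZ _ that] by simp
  have unit: "expectation (\<lambda>\<omega>. Z i \<omega> ^ 2) = 1" if "i \<in> {1, 2, 3}" for i
    using s(1)[OF that] by (simp add: Z_def power_divide s(2)[OF that, symmetric])
  define L where "L = expectation (\<lambda>\<omega>. X 1 \<omega> ^ (2 * m) * X 2 \<omega> ^ 6 * X 3 \<omega> ^ 4)"
  define R where "R = expectation (\<lambda>\<omega>. X 1 \<omega> ^ (2 * m)) * expectation (\<lambda>\<omega>. X 2 \<omega> ^ 6) * expectation (\<lambda>\<omega>. X 3 \<omega> ^ 4)"
  define A where "A = sqrt (2 * m) * expectation (\<lambda>\<omega>. Z 1 \<omega> * Z 2 \<omega>)"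
  define B where "B = sqrt (2 * m) * expectation (\<lambda>\<omega>. Z 1 \<omega> * Z 3 \<omega>)"
  define c where "c = expectation (\<lambda>\<omega>. Z 2 \<omega> * Z 3 \<omega>)"
  define h where "h = 1 / real m"
  define t where "t = tilted_moment (1 - h) ((1 - h) * (1 - 2*h)) ((1 - h) * (1 - 2*h) * (1 - 3*h))
    ((1 - h) * (1 - 2*h) * (1 - 3*h) * (1 - 4*h)) A B c"
  define \<mu> where "\<mu> = expectation (\<lambda>\<omega>. Z 1 \<omega> ^ (2 * m))"
  \<comment> \<open>Both sides of the inequality are homogeneous in each variable, so passing from
    \<open>X\<close> to \<open>Z\<close> extracts the same factor \<open>K\<close> from
    each.\<close>
  define K where "K = s 1 ^ (2 * m) * s 2 ^ 6 * s 3 ^ 4"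
  have "\<mu> > 0"
    using centered_gaussian_even_moment[OF Z, of 1 m] unit[of 1] by (simp add: \<mu>_def)
  moreover have "K > 0" unfolding K_def by (intro mult_pos_pos zero_less_power s(1)) auto
  ultimately have K\<mu>: "K * \<mu> > 0" by simp
  have m6: "expectation (\<lambda>\<omega>. Z 2 \<omega> ^ 6) = 15"
    using centered_gaussian_even_moment[OF Z, of 2 3] unit[of 2] by (simp add: fact_numeral)
  have m4: "expectation (\<lambda>\<omega>. Z 3 \<omega> ^ 4) = 3"
    using centered_gaussian_even_moment[OF Z, of 3 2] unit[of 3] by (simp add: fact_numeral)
  have "L = K * expectation (\<lambda>\<omega>. Z 1 \<omega> ^ (2 * m) * Z 2 \<omega> ^ 6 * Z 3 \<omega> ^ 4)"
  proof -
    have "X 1 \<omega> ^ (2 * m) * X 2 \<omega> ^ 6 * X 3 \<omega> ^ 4 = K * (Z 1 \<omega> ^ (2 * m) * Z 2 \<omega> ^ 6 * Z 3 \<omega> ^ 4)" for \<omega>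
      by (simp add: XZ K_def power_mult_distrib)
    then show ?thesis by (simp add: L_def)
  qed
  also have "\<dots> = K * (\<mu> * t)"
    using unit_gaussian_triple_moment(1)[OF GZ unit assms(2)]
    by (simp only: \<mu>_def t_def A_def B_def c_def h_def)
  finally have L: "L = K * \<mu> * t" by simp
  have R: "R = K * \<mu> * 45"
    using m6 m4 by (simp add: R_def K_def \<mu>_def XZ power_mult_distrib)
  have g: "gram_det h A B c \<ge> 0"
    using unit_gaussian_triple_moment(2)[OF GZ unit assms(2)] by (simp only: A_def B_def c_def h_def)
  have t: "t \<ge> 45 + A^2 + B^2 + c^2"
    using tilted_moment_bound[OF assms(2) g[unfolded h_def]] by (simp only: t_def h_def)
  have t45: "t \<ge> 45" using t by (smt (verit) zero_le_power2)
  have "L \<ge> R"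
    unfolding L R using K\<mu> t45 by (intro mult_left_mono) auto
  moreover have "indep_vars (\<lambda>_. borel) X {1, 2, 3}" if "L = R"
  proof (rule uncorrelated_gaussian_indep_vars[OF G])
    \<comment> \<open>Equality leaves no room for the excess \<open>A^2 + B^2 + c^2\<close> in the
      lower bound for \<open>t\<close>, so all three correlations vanish.\<close>
    have "t = 45" using that K\<mu> unfolding L R by auto
    then have "A^2 + B^2 + c^2 \<le> 0" using t by simp
    then have "A = 0" "B = 0" "c = 0"
      by (smt (verit) zero_le_power2 zero_eq_power2)+
    then have "expectation (\<lambda>\<omega>. Z 1 \<omega> * Z 2 \<omega>) = 0" "expectation (\<lambda>\<omega>. Z 1 \<omega> * Z 3 \<omega>) = 0"
        "expectation (\<lambda>\<omega>. Z 2 \<omega> * Z 3 \<omega>) = 0"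
      using assms(2) by (simp_all add: A_def B_def c_def)
    moreover have "expectation (\<lambda>\<omega>. Z i \<omega> * Z j \<omega>) = expectation (\<lambda>\<omega>. X i \<omega> * X j \<omega>) / (s i * s j)" for i j
      by (simp add: Z_def)
    moreover have "s i \<noteq> 0" if "i \<in> {1, 2, 3}" for i using s(1)[OF that] by simp
    ultimately have "expectation (\<lambda>\<omega>. X 1 \<omega> * X 2 \<omega>) = 0" "expectation (\<lambda>\<omega>. X 1 \<omega> * X 3 \<omega>) = 0"
        "expectation (\<lambda>\<omega>. X 2 \<omega> * X 3 \<omega>) = 0"
      by auto
    then show "expectation (\<lambda>\<omega>. X i \<omega> * X j \<omega>) = 0" if "i \<in> {1, 2, 3}" "j \<in> {1, 2, 3}" "i \<noteq> j" for i j
      using that by (auto simp: mult.commute)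
  qed auto
  moreover have "L = R" if "indep_vars (\<lambda>_. borel) X {1, 2, 3}"
    unfolding L_def R_def by (rule indep_vars_moments(2)[OF that int])
  ultimately show ?thesis unfolding L_def R_def by blast
qed

end
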